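(* Let $D\subset\mathbb{C}^n$ be a bounded homogeneous domain with $0\in D$ and $\psi\in H(D)$. (a) If $M_\psi$ is bounded on $\mathcal{B}(D)$, then $\max\{\|\psi\|_{\mathcal{B}},\|\psi\|_\infty\}\le\|M_\psi\|\le\max\{\|\psi\|_{\mathcal{B}},\|\psi\|_\infty+\sigma_\psi\}$. (b) If $M_\psi$ is bounded on $\mathcal{B}_{0^*}(D)$, then $\max\{\|\psi\|_{\mathcal{B}},\|\psi\|_\infty\}\le\|M_\psi\|\le\max\{\|\psi\|_{\mathcal{B}},\|\psi\|_\infty+\sigma_{0,\psi}\}$.
   Context: A domain $D\subset\mathbb{C}^n$ is homogeneous if its group of biholomorphic self-maps acts transitively on $D$. $H(D)$ denotes the holomorphic functions $D\to\mathbb{C}$; $\|\psi\|_\infty=\sup_{z\in D}|\psi(z)|$. For $f\in H(D)$ and $z\in D$, $Q_f(z)=\sup_{u\in\mathbb{C}^n\setminus\{0\}}\frac{|\nabla f(z)u|}{H_z(u,\bar u)^{1/2}}$, where $\nabla f(z)u=\sum_{j=1}^n\frac{\partial f}{\partial z_j}(z)u_j$ and $H_z$ is the Bergman metric of $D$; $\beta_f=\sup_{z\in D}Q_f(z)$. The Bloch space $\mathcal{B}(D)$ is the set of $f\in H(D)$ with $\beta_f<\infty$, with norm $\|f\|_{\mathcal{B}}=|f(0)|+\beta_f$. The $*$-little Bloch space is $\mathcal{B}_{0^*}(D)=\{f\in\mathcal{B}(D):\lim_{z\to\partial^*D}Q_f(z)=0\}$ with the same norm, where $\partial^*D$ is the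 distinguished boundary of $D$. Define $\omega(z)=\sup\{|f(z)|: f\in\mathcal{B}(D), f(0)=0, \|f\|_{\mathcal{B}}\le1\}$, $\omega_0(z)=\sup\{|f(z)|: f\in\mathcal{B}_{0^*}(D), f(0)=0, \|f\|_{\mathcal{B}}\le1\}$, $\sigma_\psi=\sup_{z\in D}\omega(z)Q_\psi(z)$ and $\sigma_{0,\psi}=\sup_{z\in D}\omega_0(z)Q_\psi(z)$. $M_\psi f=\psi f$ and $\|M_\psi\|$ is its operator norm. *)

theory Defs
  imports "HOL-Analysis.Analysis"
begin

definition cscale :: "complex \<Rightarrow> complex^'n \<Rightarrow> complex^'n" where
  "cscale c v = (\<chi> i. c * v $ i)"

definition holo :: "(complex^'n \<Rightarrow> complex) \<Rightarrow> (complex^'n) set \<Rightarrow> bool" where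
  "holo f D \<longleftrightarrow> (\<forall>z\<in>D. f differentiable (at z) \<and>
      (\<forall>c v. frechet_derivative f (at z) (cscale c v) = c * frechet_derivative f (at z) v))"

definition holo_map :: "(complex^'n \<Rightarrow> complex^'n) \<Rightarrow> (complex^'n) set \<Rightarrow> bool" where
  "holo_map F D \<longleftrightarrow> (\<forall>i. holo (\<lambda>z. F z $ i) D)"

definition biholomorphic :: "(complex^'n \<Rightarrow> complex^'n) \<Rightarrow> (complex^'n) set \<Rightarrow> bool" where
  "biholomorphic F D \<longleftrightarrow> (\<exists>G. holo_map F D \<and> holo_map G D \<and> F ` D \<subseteq> D \<and> G ` D \<subseteq> D \<and>
      (\<forall>z\<in>D. G (F z) = z) \<and> (\<forall>z\<in>D. F (G z) = z))"

definition domain :: "(complex^'n) set \<Rightarrow> bool" where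
  "domain D \<longleftrightarrow> open D \<and> connected D \<and> D \<noteq> {}"

definition homogeneous :: "(complex^'n) set \<Rightarrow> bool" where
  "homogeneous D \<longleftrightarrow> (\<forall>z\<in>D. \<forall>w\<in>D. \<exists>F. biholomorphic F D \<and> F z = w)"

definition bergman_kernel_diag :: "(complex^'n) set \<Rightarrow> complex^'n \<Rightarrow> real" where
  "bergman_kernel_diag D z = Sup {(cmod (f z))\<^sup>2 | f. holo f D \<and>
      (\<integral>\<^sup>+ w\<in>D. ennreal ((cmod (f w))\<^sup>2) \<partial>lborel) \<le> 1}"

text \<open>Bergman metric H_z(u, conj u) = sum_{j,k} d^2 log K(z,z)/dz_j d conj z_k u_j conj u_k,
  computed as the Levi form: (1/4) Laplacian in zeta = x + i y of log K(z + zeta u, z + zeta u)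
  at zeta = 0.\<close>
definition bergman_metric :: "(complex^'n) set \<Rightarrow> complex^'n \<Rightarrow> complex^'n \<Rightarrow> real" where
  "bergman_metric D z u =
     (let g = (\<lambda>x y. ln (bergman_kernel_diag D (z + cscale (Complex x y) u))) in
      (deriv (\<lambda>x. deriv (\<lambda>x'. g x' 0) x) 0 + deriv (\<lambda>y. deriv (\<lambda>y'. g 0 y') y) 0) / 4)"

text \<open>grad f(z) u = sum_j (d f/d z_j)(z) u_j, the complex derivative in direction u.\<close>
definition grad_dir :: "(complex^'n \<Rightarrow> complex) \<Rightarrow> complex^'n \<Rightarrow> complex^'n \<Rightarrow> complex" where
  "grad_dir f z u = frechet_derivative f (at z) u"

definition Qf :: "(complex^'n) set \<Rightarrow> (complex^'n \<Rightarrow> complex) \<Rightarrow> complex^'n \<Rightarrow> ereal" where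
  "Qf D f z = (SUP u\<in>{u. u \<noteq> 0}. ereal (cmod (grad_dir f z u) / sqrt (bergman_metric D z u)))"

definition beta :: "(complex^'n) set \<Rightarrow> (complex^'n \<Rightarrow> complex) \<Rightarrow> ereal" where
  "beta D f = (SUP z\<in>D. Qf D f z)"

definition bloch :: "(complex^'n) set \<Rightarrow> (complex^'n \<Rightarrow> complex) set" where
  "bloch D = {f. holo f D \<and> beta D f < \<infinity>}"

definition bloch_norm :: "(complex^'n) set \<Rightarrow> (complex^'n \<Rightarrow> complex) \<Rightarrow> ereal" where
  "bloch_norm D f = ereal (cmod (f 0)) + beta D f"

text \<open>Distinguished (Shilov) boundary: the smallest closed subset S of the closure of D
  such that every f continuous on the closure of D and holomorphic on D attains its
  maximum modulus on S (intersection of all such closed boundaries).\<close>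
definition dist_boundary :: "(complex^'n) set \<Rightarrow> (complex^'n) set" where
  "dist_boundary D = \<Inter> {S. closed S \<and> S \<subseteq> closure D \<and>
      (\<forall>f. continuous_on (closure D) f \<and> holo f D \<longrightarrow>
          (\<forall>x\<in>closure D. \<exists>y\<in>S. cmod (f x) \<le> cmod (f y)))}"

definition little_bloch_star :: "(complex^'n) set \<Rightarrow> (complex^'n \<Rightarrow> complex) set" where
  "little_bloch_star D = {f \<in> bloch D. \<forall>w\<in>dist_boundary D. (Qf D f \<longlongrightarrow> 0) (at w within D)}"

definition sup_norm :: "(complex^'n) set \<Rightarrow> (complex^'n \<Rightarrow> complex) \<Rightarrow> ereal" where
  "sup_norm D f = (SUP z\<in>D. ereal (cmod (f z)))"

definition omega_X :: "(complex^'n) set \<Rightarrow> (complex^'n \<Rightarrow> complex) set \<Rightarrow> complex^'n \<Rightarrow> ereal" where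
  "omega_X D X z = (SUP f\<in>{f\<in>X. f 0 = 0 \<and> bloch_norm D f \<le> 1}. ereal (cmod (f z)))"

definition sigma_X :: "(complex^'n) set \<Rightarrow> (complex^'n \<Rightarrow> complex) set \<Rightarrow> (complex^'n \<Rightarrow> complex) \<Rightarrow> ereal" where
  "sigma_X D X \<psi> = (SUP z\<in>D. omega_X D X z * Qf D \<psi> z)"

definition mult_opnorm :: "(complex^'n) set \<Rightarrow> (complex^'n \<Rightarrow> complex) set \<Rightarrow> (complex^'n \<Rightarrow> complex) \<Rightarrow> ereal" where
  "mult_opnorm D X \<psi> = (SUP f\<in>{f\<in>X. bloch_norm D f \<le> 1}. bloch_norm D (\<lambda>z. \<psi> z * f z))"

definition mult_bounded :: "(complex^'n) set \<Rightarrow> (complex^'n \<Rightarrow> complex) set \<Rightarrow> (complex^'n \<Rightarrow> complex) \<Rightarrow> bool" where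
  "mult_bounded D X \<psi> \<longleftrightarrow> (\<forall>f\<in>X. (\<lambda>z. \<psi> z * f z) \<in> X) \<and> mult_opnorm D X \<psi> < \<infinity>"

end

theory Submission
  imports Defs "HOL-Complex_Analysis.Complex_Analysis"
begin

text \<open>The estimates on \<open>M\<^sub>\<psi>\<close> rest on strict positivity of the Bergman metric.
  Testing on 1 gives \<open>\<parallel>\<psi>\<parallel>\<^sub>\<B> \<le> \<parallel>M\<^sub>\<psi>\<parallel> = m\<close>, and iterating gives \<open>\<parallel>\<psi>\<^sup>k\<parallel>\<^sub>\<B> \<le> m\<^sup>k\<close>; comparing with the gradient
  of \<open>\<psi>\<^sup>k\<close> forces \<open>\<psi>\<close> to be locally constant where \<open>\<bar>\<psi>\<bar> > m\<close>, so \<open>\<bar>\<psi>\<bar> \<le> m\<close> by connectedness. The upper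
  bound is the product rule applied to \<open>f = f(0) + g\<close>.

  Positivity of the metric requires that \<open>log K\<close> is twice differentiable. \<open>K(z, z)\<close> is the squared dual
  norm of evaluation at \<open>z\<close>, and dual norms of pre-Hilbert norms satisfy the parallelogram law, so by
  Jordan and von Neumann they come from an inner product. By Cauchy's estimates evaluation is a smooth
  curve in the dual, and the Levi form of \<open>log K\<close> is positive by strict Cauchy-Schwarz.\<close>

subsection \<open>Mean value inequality on balls\<close>

text \<open>Why positivity is indispensable: \<open>bergman_kernel_diag\<close> is a bare supremum,
  and \<open>bergman_metric\<close> is built with \<open>deriv\<close>, an unspecified value where
  no derivative exists. Where the metric vanishes, the quotient in \<open>Qf\<close> defaults to 0;
  where it is negative, so is its \<open>sqrt\<close>, and the quotient is at most 0. Either way a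
  finite \<open>beta\<close> would no longer control the gradient.

  The dual norm replaces an orthonormal basis: evaluation is a single functional, estimated on all
  test functions at once. Only the real dual is used; the complex structure returns through the
  isometry f -> i f, which links the directions u and i u.

  The bound on the modulus of \<psi> could also come from evaluation functionals on the Bloch space,
  but these must be bounded, which calls for an upper bound of the metric along paths from 0. Powers
  of \<psi> work with the derivative at single points.\<close>

lemma nn_integral_lborel_translation:
  fixes f :: "'a::euclidean_space \<Rightarrow> ennreal"
  assumes [measurable]: "f \<in> borel_measurable borel"
  shows "(\<integral>\<^sup>+x. f (c + x) \<partial>lborel) = (\<integral>\<^sup>+x. f x \<partial>lborel)"
proof -
  have "(\<integral>\<^sup>+x. f x \<partial>lborel) = (\<integral>\<^sup>+x. f x \<partial>(distr lborel borel ((+) c)))"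
    by (subst lborel_distr_plus) simp
  also have "\<dots> = (\<integral>\<^sup>+x. f (c + x) \<partial>lborel)"
    by (subst nn_integral_distr) auto
  finally show ?thesis ..
qed

text \<open>Uniqueness of translation invariant measures, done by hand. By \<open>tr\<close> the
  image measure is translation invariant; integrating \<open>b y * a (y + T x)\<close> in both
  orders compares it with \<open>lborel\<close>. The unit ball is invariant under \<open>T\<close>
  and under negation, so both sides carry the same factor, its volume, which is positive and finite
  and cancels.\<close>

lemma lborel_distr_orthogonal:
  fixes T :: "'a::euclidean_space \<Rightarrow> 'a"
  assumes T: "orthogonal_transformation T"
  shows "distr lborel borel T = lborel"
proof (rule measure_eqI)
  have lin: "linear T" using T by (rule orthogonal_transformation_linear)
  have cont: "continuous_on UNIV T" using lin by (simp add: linear_continuous_on linear_linear)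
  have Tm[measurable]: "T \<in> borel_measurable borel" using cont by (rule borel_measurable_continuous_onI)
  have surj: "\<exists>x. T x = y" for y
    using orthogonal_transformation_surj[OF T] by (metis surjD)
  have nT: "norm (T x) = norm x" for x using T by (rule orthogonal_transformation_norm)
  show "sets (distr lborel borel T) = sets lborel" by simp
  fix A :: "'a set" assume "A \<in> sets (distr lborel borel T)"
  then have [measurable]: "A \<in> sets borel" by simp
  define b :: "'a \<Rightarrow> ennreal" where "b = indicator (ball 0 1)"
  define a :: "'a \<Rightarrow> ennreal" where "a = indicator A"
  have [measurable]: "b \<in> borel_measurable borel" "a \<in> borel_measurable borel"
    unfolding b_def a_def by (rule borel_measurable_indicator, simp)+
  have tr: "(\<integral>\<^sup>+x. g (y + T x) \<partial>lborel) = (\<integral>\<^sup>+x. g (T x) \<partial>lborel)"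
    if [measurable]: "g \<in> borel_measurable borel" for y and g :: "'a \<Rightarrow> ennreal"
  proof -
    obtain y' where "T y' = y" using surj by blast
    then have "(\<integral>\<^sup>+x. g (y + T x) \<partial>lborel) = (\<integral>\<^sup>+x. g (T (y' + x)) \<partial>lborel)"
      by (simp add: linear_add[OF lin])
    also have "\<dots> = (\<integral>\<^sup>+x. g (T x) \<partial>lborel)"
      by (rule nn_integral_lborel_translation) measurable
    finally show ?thesis .
  qed
  let ?mB = "\<integral>\<^sup>+y. b y \<partial>lborel"
  have "?mB * (\<integral>\<^sup>+x. a (T x) \<partial>lborel) = (\<integral>\<^sup>+y. (\<integral>\<^sup>+x. b y * a (y + T x) \<partial>lborel) \<partial>lborel)"
    by (simp add: nn_integral_cmult nn_integral_multc tr)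
  also have "\<dots> = (\<integral>\<^sup>+x. (\<integral>\<^sup>+y. b y * a (y + T x) \<partial>lborel) \<partial>lborel)"
    by (rule lborel_pair.Fubini') measurable
  also have "\<dots> = (\<integral>\<^sup>+x. (\<integral>\<^sup>+y. b (y - T x) * a y \<partial>lborel) \<partial>lborel)"
  proof (rule nn_integral_cong)
    fix x
    have "(\<integral>\<^sup>+y. b (y - T x) * a y \<partial>lborel) = (\<integral>\<^sup>+y. b ((T x + y) - T x) * a (T x + y) \<partial>lborel)"
      by (rule nn_integral_lborel_translation[symmetric]) measurable
    then show "(\<integral>\<^sup>+y. b y * a (y + T x) \<partial>lborel) = (\<integral>\<^sup>+y. b (y - T x) * a y \<partial>lborel)"
      by (simp add: add.commute)
  qed
  also have "\<dots> = (\<integral>\<^sup>+y. (\<integral>\<^sup>+x. b (y - T x) * a y \<partial>lborel) \<partial>lborel)"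
    by (rule lborel_pair.Fubini') measurable
  also have "\<dots> = (\<integral>\<^sup>+y. (\<integral>\<^sup>+x. b x \<partial>lborel) * a y \<partial>lborel)"
  proof (rule nn_integral_cong)
    fix y
    have beq: "b (- z) = b z" "b (T z) = b z" for z by (auto simp: b_def nT split: split_indicator)
    have "(\<integral>\<^sup>+x. b (y - T x) \<partial>lborel) = (\<integral>\<^sup>+x. b (- y + T x) \<partial>lborel)"
      using beq(1)[of "y - T _"] by (simp add: algebra_simps)
    also have "\<dots> = (\<integral>\<^sup>+x. b x \<partial>lborel)" by (subst tr) (simp_all add: beq)
    finally show "(\<integral>\<^sup>+x. b (y - T x) * a y \<partial>lborel) = (\<integral>\<^sup>+x. b x \<partial>lborel) * a y"
      by (simp add: nn_integral_multc)
  qed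
  also have "\<dots> = ?mB * (\<integral>\<^sup>+y. a y \<partial>lborel)"
    by (simp add: nn_integral_cmult)
  finally have eq: "?mB * (\<integral>\<^sup>+x. a (T x) \<partial>lborel) = ?mB * (\<integral>\<^sup>+y. a y \<partial>lborel)" .
  have mB: "?mB = emeasure lborel (ball 0 1 :: 'a set)" unfolding b_def by simp
  have "?mB \<noteq> \<infinity>" unfolding mB using emeasure_bounded_finite[OF bounded_ball] by (metis less_irrefl)
  moreover have "?mB \<noteq> 0"
  proof -
    have "0 < measure lborel (ball (0::'a) 1)" using content_ball_pos[of 1 "0::'a"] by simp
    then show ?thesis unfolding mB by (auto simp: measure_def)
  qed
  ultimately have "(\<integral>\<^sup>+x. a (T x) \<partial>lborel) = (\<integral>\<^sup>+y. a y \<partial>lborel)"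
    using eq by (simp add: ennreal_mult_cancel_left)
  moreover have "emeasure (distr lborel borel T) A = (\<integral>\<^sup>+x. a x \<partial>distr lborel borel T)"
    by (simp add: a_def)
  moreover have "\<dots> = (\<integral>\<^sup>+x. a (T x) \<partial>lborel)"
    by (rule nn_integral_distr) measurable
  ultimately show "emeasure (distr lborel borel T) A = emeasure lborel A"
    by (simp add: a_def)
qed

section \<open>Complex scaling and restriction to complex lines\<close>

lemma norm_cscale: "norm (cscale c v) = cmod c * norm v"
  by (simp add: cscale_def norm_vec_def norm_mult L2_set_right_distrib)

lemma cscale_cscale [simp]: "cscale a (cscale b v) = cscale (a * b) v"
  by (simp add: cscale_def vec_eq_iff mult.assoc)

lemma cscale_0 [simp]: "cscale 0 v = 0" "cscale c 0 = 0"
  by (simp_all add: cscale_def vec_eq_iff)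

lemma cscale_add: "cscale (a + b) v = cscale a v + cscale b v"
  by (simp add: cscale_def vec_eq_iff algebra_simps)

lemma continuous_on_cscale [continuous_intros]:
  "continuous_on S f \<Longrightarrow> continuous_on S g \<Longrightarrow> continuous_on S (\<lambda>x. cscale (f x) (g x))"
  unfolding cscale_def by (intro continuous_intros)

lemma bounded_linear_cscale_left: "bounded_linear (\<lambda>c. cscale c v)"
  by (rule bounded_linear_intro[where K = "norm v"])
    (simp_all add: cscale_add norm_cscale, simp add: cscale_def vec_eq_iff)

lemma linear_cscale_right: "linear (cscale c)"
  by (rule linearI) (auto simp: cscale_def vec_eq_iff algebra_simps)

lemma orthogonal_transformation_cscale:
  assumes "cmod c = 1"
  shows "orthogonal_transformation (cscale c)"
  unfolding orthogonal_transformation using assms by (simp add: norm_cscale linear_cscale_right)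

lemma holo_has_derivative:
  assumes "holo f D" "z \<in> D"
  shows "(f has_derivative frechet_derivative f (at z)) (at z)"
  using assms by (simp add: holo_def frechet_derivative_works)

lemma holo_continuous_on:
  assumes "holo f D"
  shows "continuous_on D f"
  using holo_has_derivative[OF assms] has_derivative_continuous
  by (metis continuous_at_imp_continuous_on)

text \<open>The complex linearity demanded by \<open>holo\<close> turns the real chain rule into a
  complex derivative, which opens the one-variable theory for slices.\<close>

lemma holo_slice_deriv:
  assumes f: "holo f D" and z: "z + cscale \<zeta> u \<in> D"
  shows "((\<lambda>\<zeta>. f (z + cscale \<zeta> u)) has_field_derivative
            frechet_derivative f (at (z + cscale \<zeta> u)) u) (at \<zeta>)"
proof -
  have "((\<lambda>\<zeta>. z + cscale \<zeta> u) has_derivative (\<lambda>h. cscale h u)) (at \<zeta>)"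
    using bounded_linear.has_derivative[OF bounded_linear_cscale_left has_derivative_ident]
    by (auto intro!: derivative_eq_intros)
  from diff_chain_at[OF this holo_has_derivative[OF f z]]
  have "((\<lambda>\<zeta>. f (z + cscale \<zeta> u)) has_derivative
      (\<lambda>h. frechet_derivative f (at (z + cscale \<zeta> u)) (cscale h u))) (at \<zeta>)"
    by (simp add: o_def)
  moreover have "frechet_derivative f (at (z + cscale \<zeta> u)) (cscale h u)
      = h * frechet_derivative f (at (z + cscale \<zeta> u)) u" for h
    using f z unfolding holo_def by blast
  ultimately have "((\<lambda>\<zeta>. f (z + cscale \<zeta> u)) has_derivative
      (\<lambda>h. h * frechet_derivative f (at (z + cscale \<zeta> u)) u)) (at \<zeta>)"
    by (simp only:)
  then show ?thesis
    by (simp add: has_field_derivative_def mult.commute[of _ "frechet_derivative f (at (z + cscale \<zeta> u)) u"])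
qed

lemma holo_slice_holomorphic:
  assumes "holo f D" "\<And>\<zeta>. \<zeta> \<in> S \<Longrightarrow> z + cscale \<zeta> u \<in> D"
  shows "(\<lambda>\<zeta>. f (z + cscale \<zeta> u)) holomorphic_on S"
  unfolding holomorphic_on_def field_differentiable_def
  using holo_slice_deriv[OF assms(1)] assms(2) has_field_derivative_at_within by blast

text \<open>Cauchy's formula is applied to the square of \<open>g\<close>, which is again
  holomorphic, so the bound on squares comes out directly. Parametrizing the circle by [0, 1] gives
  the mean total weight 1.\<close>

lemma circle_mean_square_le:
  assumes "g holomorphic_on cball 0 1"
  shows "ennreal ((cmod (g 0))\<^sup>2)
          \<le> (\<integral>\<^sup>+t. ennreal ((cmod (g (cis (2 * pi * t))))\<^sup>2) * indicator {0..1} t \<partial>lborel)"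
proof -
  let ?G = "\<lambda>t. (g (cis (2 * pi * t)))\<^sup>2"
  have cont: "continuous_on {0..1} ?G"
  proof -
    have "continuous_on (cball 0 1) g" using assms by (rule holomorphic_on_imp_continuous_on)
    moreover have "continuous_on {0..1} (\<lambda>t. cis (2 * pi * t))"
      by (intro continuous_intros)
    ultimately have "continuous_on {0..1} (\<lambda>t. g (cis (2 * pi * t)))"
      by (rule continuous_on_compose2) auto
    then show ?thesis by (intro continuous_intros)
  qed
  have "((\<lambda>u. (g u)\<^sup>2 / (u - 0)) has_contour_integral (2 * of_real pi * \<i> * (g 0)\<^sup>2)) (circlepath 0 1)"
    by (rule Cauchy_integral_circlepath_simple) (auto intro!: holomorphic_intros assms)
  then have "((\<lambda>x. (g (circlepath 0 1 x))\<^sup>2 / circlepath 0 1 x * vector_derivative (circlepath 0 1) (at x))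
      has_integral (2 * of_real pi * \<i> * (g 0)\<^sup>2)) {0..1}"
    by (simp add: has_contour_integral)
  moreover have "(g (circlepath 0 1 x))\<^sup>2 / circlepath 0 1 x * vector_derivative (circlepath 0 1) (at x)
      = (2 * of_real pi * \<i>) * ?G x" for x
    unfolding vector_derivative_circlepath by (simp add: circlepath cis_conv_exp mult_ac)
  ultimately have "((\<lambda>x. (2 * of_real pi * \<i>) * ?G x) has_integral (2 * of_real pi * \<i> * (g 0)\<^sup>2)) {0..1}"
    by simp
  from has_integral_mult_right[OF this, of "inverse (2 * of_real pi * \<i>)"]
  have int: "(?G has_integral (g 0)\<^sup>2) {0..1}"
    by (simp add: field_simps)
  have nint: "(\<lambda>t. norm (?G t)) integrable_on {0..1}"
    by (intro integrable_continuous_interval continuous_intros cont)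
  have "(cmod (g 0))\<^sup>2 = norm (integral {0..1} ?G)"
    using int by (simp add: integral_unique norm_power)
  also have "\<dots> \<le> integral {0..1} (\<lambda>t. norm (?G t))"
    using integral_norm_bound_integral[OF _ nint, of ?G] int by blast
  finally have "ennreal ((cmod (g 0))\<^sup>2) \<le> ennreal (integral {0..1} (\<lambda>t. norm (?G t)))"
    by (rule ennreal_leI)
  also have "\<dots> = (\<integral>\<^sup>+t. ennreal (norm (?G t)) * indicator {0..1} t \<partial>lborel)"
    by (rule nn_integral_has_integral_lebesgue'[symmetric])
      (use nint in \<open>auto intro: integrable_integral\<close>)
  finally show ?thesis by (simp add: norm_power)
qed

lemma holo_square_measurable:
  assumes f: "holo f D" and D: "open D"
  shows "(\<lambda>w. ennreal ((cmod (f w))\<^sup>2) * indicator D w) \<in> borel_measurable borel"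
proof -
  have "(\<lambda>w. indicator D w *\<^sub>R (cmod (f w))\<^sup>2) \<in> borel_measurable borel"
    by (intro borel_measurable_continuous_on_indicator continuous_intros holo_continuous_on[OF f])
      (use D in auto)
  then have "(\<lambda>w. ennreal (indicator D w *\<^sub>R (cmod (f w))\<^sup>2)) \<in> borel_measurable borel"
    by measurable
  moreover have "(\<lambda>w. ennreal (indicator D w *\<^sub>R (cmod (f w))\<^sup>2))
      = (\<lambda>w. ennreal ((cmod (f w))\<^sup>2) * indicator D w)"
    by (auto simp: fun_eq_iff split: split_indicator)
  ultimately show ?thesis by (simp only:)
qed

text \<open>The circle inequality is averaged over all directions \<open>v\<close> in a ball and the
  integrals are exchanged. For fixed \<open>t\<close> the rotation by
  \<open>cis (2 * pi * t)\<close> is orthogonal and preserves both the ball and Lebesgue measure, so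
  polar coordinates are avoided.\<close>

lemma holo_sub_mean_value:
  fixes D :: "(complex^'n) set"
  assumes f: "holo f D" and D: "open D" and r: "ball w r \<subseteq> D"
  shows "ennreal ((cmod (f w))\<^sup>2) * emeasure lborel (ball (0::complex^'n) r)
          \<le> (\<integral>\<^sup>+x\<in>D. ennreal ((cmod (f x))\<^sup>2) \<partial>lborel)"
proof -
  define h where "h = (\<lambda>w. ennreal ((cmod (f w))\<^sup>2) * indicator D w)"
  have hm [measurable]: "h \<in> borel_measurable borel"
    unfolding h_def by (rule holo_square_measurable[OF f D])
  define B :: "complex^'n \<Rightarrow> ennreal" where "B = indicator (ball 0 r)"
  have [measurable]: "B \<in> borel_measurable borel"
    unfolding B_def by (rule borel_measurable_indicator, simp)
  define I :: "real \<Rightarrow> ennreal" where "I = indicator {0..1}"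
  have [measurable]: "I \<in> borel_measurable borel"
    unfolding I_def by (rule borel_measurable_indicator, simp)
  let ?T = "\<lambda>t. cscale (cis (2 * pi * t)) :: complex^'n \<Rightarrow> complex^'n"
  have [measurable]: "I \<in> borel_measurable lborel"
    by simp
  have [measurable]: "(\<lambda>p. ?T (snd p) (fst p)) \<in> borel_measurable (borel \<Otimes>\<^sub>M borel)"
    unfolding borel_prod by (intro borel_measurable_continuous_onI continuous_intros)
  have [measurable]: "?T t \<in> borel_measurable borel" for t
    by (intro borel_measurable_continuous_onI continuous_intros)
  have *: "ennreal ((cmod (f w))\<^sup>2) * B v \<le> (\<integral>\<^sup>+t. B v * (h (w + ?T t v) * I t) \<partial>lborel)" for v
  proof (cases "v \<in> ball 0 r")
    case True
    have inD: "w + cscale \<zeta> v \<in> D" if "\<zeta> \<in> cball 0 1" for \<zeta>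
    proof -
      have "cmod \<zeta> * norm v \<le> 1 * norm v" using that by (intro mult_right_mono) auto
      then show ?thesis using True r by (auto simp: dist_norm norm_cscale)
    qed
    have "ennreal ((cmod (f w))\<^sup>2) = ennreal ((cmod (f (w + cscale 0 v)))\<^sup>2)" by simp
    also have "\<dots> \<le> (\<integral>\<^sup>+t. ennreal ((cmod (f (w + ?T t v)))\<^sup>2) * indicator {0..1} t \<partial>lborel)"
      by (rule circle_mean_square_le, rule holo_slice_holomorphic[OF f inD])
    also have "\<dots> = (\<integral>\<^sup>+t. B v * (h (w + ?T t v) * I t) \<partial>lborel)"
      using True inD by (intro nn_integral_cong) (auto simp: B_def h_def I_def)
    finally show ?thesis using True by (simp add: B_def)
  qed (simp add: B_def)
  have "ennreal ((cmod (f w))\<^sup>2) * emeasure lborel (ball (0::complex^'n) r)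
      = (\<integral>\<^sup>+v. ennreal ((cmod (f w))\<^sup>2) * B v \<partial>lborel)"
    by (simp add: nn_integral_cmult) (simp add: B_def)
  also have "\<dots> \<le> (\<integral>\<^sup>+v. (\<integral>\<^sup>+t. B v * (h (w + ?T t v) * I t) \<partial>lborel) \<partial>lborel)"
    by (intro nn_integral_mono *)
  also have "\<dots> = (\<integral>\<^sup>+t. (\<integral>\<^sup>+v. B v * (h (w + ?T t v) * I t) \<partial>lborel) \<partial>lborel)"
    by (rule lborel_pair.Fubini'[symmetric]) measurable
  also have "\<dots> \<le> (\<integral>\<^sup>+t. (\<integral>\<^sup>+v. h v \<partial>lborel) * I t \<partial>lborel)"
  proof (rule nn_integral_mono)
    fix t
    have "(\<integral>\<^sup>+v. B v * (h (w + ?T t v) * I t) \<partial>lborel)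
        = (\<integral>\<^sup>+v. B (?T t v) * (h (w + ?T t v) * I t) \<partial>lborel)"
      by (simp add: B_def norm_cscale indicator_def)
    also have "\<dots> = (\<integral>\<^sup>+v. B v * (h (w + v) * I t) \<partial>(distr lborel borel (?T t)))"
      by (subst nn_integral_distr) measurable
    also have "\<dots> = (\<integral>\<^sup>+v. B v * (h (w + v) * I t) \<partial>lborel)"
      by (subst lborel_distr_orthogonal) (auto intro: orthogonal_transformation_cscale)
    also have "\<dots> \<le> (\<integral>\<^sup>+v. h (w + v) * I t \<partial>lborel)"
      by (intro nn_integral_mono) (auto simp: B_def split: split_indicator)
    also have "\<dots> = (\<integral>\<^sup>+v. h v \<partial>lborel) * I t"
      by (simp add: nn_integral_multc nn_integral_lborel_translation)
    finally show "(\<integral>\<^sup>+v. B v * (h (w + ?T t v) * I t) \<partial>lborel) \<le> (\<integral>\<^sup>+v. h v \<partial>lborel) * I t" .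
  qed
  also have "\<dots> = (\<integral>\<^sup>+v. h v \<partial>lborel)"
    by (simp add: nn_integral_cmult) (simp add: I_def)
  finally show ?thesis by (simp add: h_def)
qed

subsection \<open>Forms satisfying the parallelogram law\<close>

text \<open>\<open>L\<close> is a carrier set of functionals with pointwise operations, and
  \<open>q\<close> plays the role of a squared seminorm on it.\<close>

locale parallelogram_form =
  fixes L :: "('v \<Rightarrow> real) set" and q :: "('v \<Rightarrow> real) \<Rightarrow> real"
  assumes L_add: "\<phi> \<in> L \<Longrightarrow> \<psi> \<in> L \<Longrightarrow> (\<lambda>f. \<phi> f + \<psi> f) \<in> L"
    and L_scale: "\<phi> \<in> L \<Longrightarrow> (\<lambda>f. c * \<phi> f) \<in> L"
    and q_nonneg: "\<phi> \<in> L \<Longrightarrow> 0 \<le> q \<phi>"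
    and q_scale: "\<phi> \<in> L \<Longrightarrow> q (\<lambda>f. c * \<phi> f) = c\<^sup>2 * q \<phi>"
    and parallelogram: "\<phi> \<in> L \<Longrightarrow> \<psi> \<in> L \<Longrightarrow>
      q (\<lambda>f. \<phi> f + \<psi> f) + q (\<lambda>f. \<phi> f - \<psi> f) = 2 * q \<phi> + 2 * q \<psi>"
begin

text \<open>Polarization: the inner product that Jordan and von Neumann attach to
  \<open>q\<close>.\<close>

definition r :: "('v \<Rightarrow> real) \<Rightarrow> ('v \<Rightarrow> real) \<Rightarrow> real" where
  "r \<phi> \<psi> = (q (\<lambda>f. \<phi> f + \<psi> f) - q (\<lambda>f. \<phi> f - \<psi> f)) / 4"

lemma L_diff: "\<phi> \<in> L \<Longrightarrow> \<psi> \<in> L \<Longrightarrow> (\<lambda>f. \<phi> f - \<psi> f) \<in> L"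
  using L_add[of \<phi> "\<lambda>f. (-1) * \<psi> f"] L_scale[of \<psi> "-1"] by simp

lemma L_minus: "\<phi> \<in> L \<Longrightarrow> (\<lambda>f. - \<phi> f) \<in> L"
  using L_scale[of \<phi> "-1"] by simp

lemmas L_closed = L_add L_diff L_minus L_scale

lemma q_minus: "\<phi> \<in> L \<Longrightarrow> q (\<lambda>f. - \<phi> f) = q \<phi>"
  using q_scale[of \<phi> "-1"] by simp

lemma q_diff_commute:
  assumes "\<phi> \<in> L" "\<psi> \<in> L"
  shows "q (\<lambda>f. \<phi> f - \<psi> f) = q (\<lambda>f. \<psi> f - \<phi> f)"
  using q_minus[OF L_diff[OF assms]] by simp

lemma r_commute:
  assumes "\<phi> \<in> L" "\<psi> \<in> L"
  shows "r \<phi> \<psi> = r \<psi> \<phi>"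
  unfolding r_def using q_diff_commute[OF assms] by (simp add: add.commute)

lemma r_self: "\<phi> \<in> L \<Longrightarrow> r \<phi> \<phi> = q \<phi>"
  using q_scale[of \<phi> 2] q_scale[of \<phi> 0] by (simp add: r_def)

lemma r_minus_left:
  assumes "\<phi> \<in> L" "\<psi> \<in> L"
  shows "r (\<lambda>f. - \<phi> f) \<psi> = - r \<phi> \<psi>"
proof -
  have "q (\<lambda>f. - \<phi> f + \<psi> f) = q (\<lambda>f. \<phi> f - \<psi> f)"
    using q_minus[OF L_diff[OF assms]] by simp
  moreover have "q (\<lambda>f. - \<phi> f - \<psi> f) = q (\<lambda>f. \<phi> f + \<psi> f)"
    using q_minus[OF L_add[OF assms]] by simp
  ultimately show ?thesis unfolding r_def by (simp only: minus_divide_left minus_diff_eq)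
qed

text \<open>The parallelogram law for the pairs \<phi> + \<psi>, \<eta> and \<phi> - \<psi>, \<eta>
  gives \<open>*\<close>, the terms \<open>q \<eta>\<close> cancelling. Exchanging \<phi> and \<eta>
  in \<open>*\<close> flips the sign of its second term, so the sum of the two instances is twice
  the claim.\<close>

lemma r_add_left:
  assumes "\<phi> \<in> L" "\<eta> \<in> L" "\<psi> \<in> L"
  shows "r (\<lambda>f. \<phi> f + \<eta> f) \<psi> = r \<phi> \<psi> + r \<eta> \<psi>"
proof -
  have arith: "(a - b) / 4 + (c - d) / 4 = 2 * ((p - q) / 4)"
    if "a + c = 2 * p + 2 * e" "b + d = 2 * q + 2 * e" for a b c d e p q :: real
    using that by (simp add: abs_le_iff field_simps)
  have *: "r (\<lambda>f. \<phi> f + \<eta> f) \<psi> + r (\<lambda>f. \<phi> f - \<eta> f) \<psi> = 2 * r \<phi> \<psi>"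
    if "\<phi> \<in> L" "\<eta> \<in> L" for \<phi> \<eta>
    unfolding r_def
  proof (rule arith)
    show "q (\<lambda>f. \<phi> f + \<eta> f + \<psi> f) + q (\<lambda>f. \<phi> f - \<eta> f + \<psi> f) = 2 * q (\<lambda>f. \<phi> f + \<psi> f) + 2 * q \<eta>"
      using parallelogram[OF L_add[OF that(1) assms(3)] that(2)] by (simp add: algebra_simps)
    show "q (\<lambda>f. \<phi> f + \<eta> f - \<psi> f) + q (\<lambda>f. \<phi> f - \<eta> f - \<psi> f) = 2 * q (\<lambda>f. \<phi> f - \<psi> f) + 2 * q \<eta>"
      using parallelogram[OF L_diff[OF that(1) assms(3)] that(2)] by (simp add: algebra_simps)
  qed
  have "r (\<lambda>f. \<eta> f - \<phi> f) \<psi> = - r (\<lambda>f. \<phi> f - \<eta> f) \<psi>"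
    using r_minus_left[OF L_diff[OF assms(1,2)] assms(3)] by simp
  then show ?thesis
    using *[OF assms(1,2)] *[OF assms(2,1)] by (simp add: add.commute)
qed

lemma r_diff_left:
  assumes "\<phi> \<in> L" "\<eta> \<in> L" "\<psi> \<in> L"
  shows "r (\<lambda>f. \<phi> f - \<eta> f) \<psi> = r \<phi> \<psi> - r \<eta> \<psi>"
  using r_add_left[OF assms(1) L_minus[OF assms(2)] assms(3)] r_minus_left[OF assms(2,3)] by simp

text \<open>A crude substitute for Cauchy-Schwarz, whose proof relies on homogeneity. It yields the
  boundedness on [0, 1] from which \<open>r_scale_left\<close> derives homogeneity.\<close>

lemma r_bound:
  assumes "\<phi> \<in> L" "\<psi> \<in> L"
  shows "\<bar>r \<phi> \<psi>\<bar> \<le> q \<phi> + q \<psi>"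
proof -
  have arith: "\<bar>(a - b) / 4\<bar> \<le> p + s" if "a + b = 2 * p + 2 * s" "0 \<le> a" "0 \<le> b" for a b p s :: real
    using that by (simp add: abs_le_iff field_simps)
  show ?thesis
    unfolding r_def using parallelogram[OF assms] q_nonneg[OF L_add[OF assms]] q_nonneg[OF L_diff[OF assms]]
    by (rule arith)
qed

text \<open>An additive function that is bounded on \<open>[0, 1]\<close> is linear: its deviation from a linear
  function is additive and 1-periodic, hence bounded, hence zero.\<close>

lemma additive_bounded_imp_linear:
  fixes a :: "real \<Rightarrow> real"
  assumes add: "\<And>s t. a (s + t) = a s + a t"
    and bd: "\<And>t. 0 \<le> t \<Longrightarrow> t \<le> 1 \<Longrightarrow> \<bar>a t\<bar> \<le> C"
  shows "a t = t * a 1"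
proof -
  define d where "d t = a t - t * a 1" for t
  have dadd: "d (s + t) = d s + d t" for s t by (simp add: d_def add algebra_simps)
  have d0: "d 0 = 0" using dadd[of 0 0] by simp
  have dn: "d (real n * t) = real n * d t" for n t
    by (induction n) (simp_all add: d0 dadd algebra_simps)
  have dminus: "d (- t) = - d t" for t using dadd[of t "-t"] d0 by simp
  have d1: "d (real n) = 0" for n using dn[of n 1] by (simp add: d_def)
  have dint: "d (of_int k) = 0" for k :: int
    using d1 dminus by (cases k) (simp_all del: of_nat_Suc)
  have bound: "\<bar>d t\<bar> \<le> C + \<bar>a 1\<bar>" for t
  proof -
    have "d t = d (of_int \<lfloor>t\<rfloor> + frac t)" by (simp add: frac_def)
    also have "\<dots> = d (frac t)" by (simp only: dadd dint)
    finally have "d t = d (frac t)" .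
    moreover have "\<bar>frac t * a 1\<bar> \<le> 1 * \<bar>a 1\<bar>"
      unfolding abs_mult by (intro mult_right_mono) (auto simp: frac_lt_1 less_imp_le)
    moreover have "\<bar>a (frac t)\<bar> \<le> C" by (rule bd) (auto simp: frac_lt_1 less_imp_le)
    ultimately show ?thesis unfolding d_def by linarith
  qed
  have "d t = 0"
  proof (rule ccontr)
    assume "d t \<noteq> 0"
    then obtain n where "C + \<bar>a 1\<bar> < real n * \<bar>d t\<bar>"
      using reals_Archimedean3[of "\<bar>d t\<bar>"] by auto
    then show False using bound[of "real n * t"] by (simp add: dn abs_mult)
  qed
  then show ?thesis by (simp add: d_def)
qed

lemma r_scale_left:
  assumes "\<phi> \<in> L" "\<psi> \<in> L"
  shows "r (\<lambda>f. c * \<phi> f) \<psi> = c * r \<phi> \<psi>"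
proof -
  define a where "a t = r (\<lambda>f. t * \<phi> f) \<psi>" for t
  have "a (s + t) = a s + a t" for s t
    unfolding a_def using r_add_left[OF L_scale[OF assms(1)] L_scale[OF assms(1)] assms(2)]
    by (simp add: algebra_simps)
  moreover have "\<bar>a t\<bar> \<le> q \<phi> + q \<psi>" if "0 \<le> t" "t \<le> 1" for t
  proof -
    have "t\<^sup>2 * q \<phi> \<le> 1 * q \<phi>"
      using that assms by (intro mult_right_mono q_nonneg) (auto simp: power_le_one)
    then show ?thesis
      unfolding a_def using r_bound[OF L_scale[OF assms(1)] assms(2), of t] q_scale[OF assms(1), of t]
      by simp
  qed
  ultimately have "a c = c * a 1" by (rule additive_bounded_imp_linear)
  then show ?thesis by (simp add: a_def)
qed

lemma r_add_right:
  assumes "\<phi> \<in> L" "\<eta> \<in> L" "\<psi> \<in> L"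
  shows "r \<psi> (\<lambda>f. \<phi> f + \<eta> f) = r \<psi> \<phi> + r \<psi> \<eta>"
  using r_commute[OF assms(3) L_add[OF assms(1,2)]] r_add_left[OF assms] r_commute[OF assms(3,1)] r_commute[OF assms(3,2)] by simp

lemma r_diff_right:
  assumes "\<phi> \<in> L" "\<eta> \<in> L" "\<psi> \<in> L"
  shows "r \<psi> (\<lambda>f. \<phi> f - \<eta> f) = r \<psi> \<phi> - r \<psi> \<eta>"
  using r_commute[OF assms(3) L_diff[OF assms(1,2)]] r_diff_left[OF assms] r_commute[OF assms(3,1)] r_commute[OF assms(3,2)] by simp

lemma r_scale_right:
  assumes "\<phi> \<in> L" "\<psi> \<in> L"
  shows "r \<psi> (\<lambda>f. c * \<phi> f) = c * r \<psi> \<phi>"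
  using r_commute[OF assms(2) L_scale[OF assms(1), of c]] r_scale_left[OF assms] r_commute[OF assms(2,1)] by simp

lemma r_minus_right:
  assumes "\<phi> \<in> L" "\<psi> \<in> L"
  shows "r \<psi> (\<lambda>f. - \<phi> f) = - r \<psi> \<phi>"
  using r_commute[OF assms(2) L_minus[OF assms(1)]] r_minus_left[OF assms] r_commute[OF assms(2,1)] by simp

lemma Cauchy_Schwarz:
  assumes L: "\<phi> \<in> L" "\<psi> \<in> L"
  shows "\<bar>r \<phi> \<psi>\<bar> \<le> sqrt (q \<phi> * q \<psi>)"
proof -
  have exp: "0 \<le> q \<phi> + 2 * t * r \<phi> \<psi> + t\<^sup>2 * q \<psi>" for t
  proof -
    have "q (\<lambda>f. \<phi> f + t * \<psi> f) = r (\<lambda>f. \<phi> f + t * \<psi> f) (\<lambda>f. \<phi> f + t * \<psi> f)"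
      using L by (simp add: r_self L_closed)
    also have "\<dots> = q \<phi> + 2 * t * r \<phi> \<psi> + t\<^sup>2 * q \<psi>"
      using L by (simp add: r_add_left r_add_right r_scale_left r_scale_right L_closed r_self
          r_commute[of \<psi> \<phi>] power2_eq_square algebra_simps)
    finally show ?thesis using q_nonneg[of "\<lambda>f. \<phi> f + t * \<psi> f"] L by (simp add: L_closed)
  qed
  have "(r \<phi> \<psi>)\<^sup>2 \<le> q \<phi> * q \<psi>"
  proof (cases "q \<psi> = 0")
    case True
    have "r \<phi> \<psi> = 0"
    proof (rule ccontr)
      assume "r \<phi> \<psi> \<noteq> 0"
      \<comment> \<open>For degenerate \<psi> the expression is affine in \<open>t\<close>; this
        \<open>t\<close> gives it the value -1.\<close>
      then show False using exp[of "- (q \<phi> + 1) / (2 * r \<phi> \<psi>)"] True by (simp add: field_simps)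
    qed
    then show ?thesis using True by simp
  next
    case False
    then have "0 < q \<psi>" using q_nonneg[OF L(2)] by simp
    then show ?thesis using exp[of "- r \<phi> \<psi> / q \<psi>"]
      by (simp add: field_simps power2_eq_square)
  qed
  then show ?thesis by (intro real_le_rsqrt) simp
qed

section \<open>Differential calculus for curves of functionals\<close>

definition qlim :: "('b \<Rightarrow> 'v \<Rightarrow> real) \<Rightarrow> ('v \<Rightarrow> real) \<Rightarrow> 'b filter \<Rightarrow> bool" where
  "qlim P \<phi> F \<longleftrightarrow> ((\<lambda>h. q (\<lambda>f. P h f - \<phi> f)) \<longlongrightarrow> 0) F"

lemma qlim_const: "\<phi> \<in> L \<Longrightarrow> qlim (\<lambda>h. \<phi>) \<phi> F"
  unfolding qlim_def using q_scale[of \<phi> 0] by simp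

lemma tendsto_r:
  assumes P: "qlim P \<phi> F" "\<And>h. P h \<in> L" "\<phi> \<in> L"
    and Q: "qlim Q \<psi> F" "\<And>h. Q h \<in> L" "\<psi> \<in> L"
  shows "((\<lambda>h. r (P h) (Q h)) \<longlongrightarrow> r \<phi> \<psi>) F"
proof -
  let ?p = "\<lambda>h. q (\<lambda>f. P h f - \<phi> f)" and ?q = "\<lambda>h. q (\<lambda>f. Q h f - \<psi> f)"
  have bound: "\<bar>r (P h) (Q h) - r \<phi> \<psi>\<bar>
      \<le> sqrt (?p h * ?q h) + sqrt (?p h * q \<psi>) + sqrt (q \<phi> * ?q h)" for h
  proof -
    let ?A = "\<lambda>f. P h f - \<phi> f" and ?B = "\<lambda>f. Q h f - \<psi> f"
    have L: "?A \<in> L" "?B \<in> L" using P Q by (auto intro: L_closed)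
    have "r (P h) (Q h) - r \<phi> \<psi> = r ?A ?B + r ?A \<psi> + r \<phi> ?B"
      using P Q by (simp add: r_diff_left r_diff_right L_closed)
    then show ?thesis
      using Cauchy_Schwarz[OF L] Cauchy_Schwarz[OF L(1) Q(3)] Cauchy_Schwarz[OF P(3) L(2)] by linarith
  qed
  have "((\<lambda>h. sqrt (?p h * ?q h) + sqrt (?p h * q \<psi>) + sqrt (q \<phi> * ?q h))
      \<longlongrightarrow> sqrt (0 * 0) + sqrt (0 * q \<psi>) + sqrt (q \<phi> * 0)) F"
    by (intro tendsto_intros P(1)[unfolded qlim_def] Q(1)[unfolded qlim_def])
  then have "((\<lambda>h. r (P h) (Q h) - r \<phi> \<psi>) \<longlongrightarrow> 0) F"
    by (intro Lim_null_comparison[of "\<lambda>h. r (P h) (Q h) - r \<phi> \<psi>"]) (use bound in auto)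
  then show ?thesis by (rule LIM_zero_cancel)
qed

definition has_qderiv :: "(real \<Rightarrow> 'v \<Rightarrow> real) \<Rightarrow> ('v \<Rightarrow> real) \<Rightarrow> real \<Rightarrow> bool" where
  "has_qderiv P \<phi> x \<longleftrightarrow> qlim (\<lambda>h f. (P (x + h) f - P x f) / h) \<phi> (at 0)"

lemma has_qderiv_imp_qlim:
  assumes P: "has_qderiv P \<phi> x" "\<And>h. P h \<in> L" "\<phi> \<in> L"
  shows "qlim (\<lambda>h. P (x + h)) (P x) (at 0)"
  unfolding qlim_def
proof (rule Lim_null_comparison)
  let ?D = "\<lambda>h f. (P (x + h) f - P x f) / h"
  have DL: "?D h \<in> L" for h
    using L_scale[OF L_diff[OF P(2)[of "x + h"] P(2)[of x]], of "1 / h"] by simp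
  show "((\<lambda>h. h\<^sup>2 * (2 * q (\<lambda>f. ?D h f - \<phi> f) + 2 * q \<phi>)) \<longlongrightarrow> 0) (at 0)"
  proof -
    have "((\<lambda>h. h\<^sup>2 * (2 * q (\<lambda>f. ?D h f - \<phi> f) + 2 * q \<phi>)) \<longlongrightarrow> 0\<^sup>2 * (2 * 0 + 2 * q \<phi>)) (at 0)"
      by (intro tendsto_intros P(1)[unfolded has_qderiv_def qlim_def])
    then show ?thesis by simp
  qed
  show "\<forall>\<^sub>F h in at 0. norm (q (\<lambda>f. P (x + h) f - P x f))
      \<le> h\<^sup>2 * (2 * q (\<lambda>f. ?D h f - \<phi> f) + 2 * q \<phi>)"
  proof -
    have "norm (q (\<lambda>f. P (x + h) f - P x f)) \<le> h\<^sup>2 * (2 * q (\<lambda>f. ?D h f - \<phi> f) + 2 * q \<phi>)"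
      if h: "h \<noteq> 0" for h
    proof -
    \<comment> \<open>The parallelogram law with one of its two nonnegative terms dropped serves as
      triangle inequality.\<close>
    have "q (?D h) \<le> 2 * q (\<lambda>f. ?D h f - \<phi> f) + 2 * q \<phi>"
      using parallelogram[OF L_diff[OF DL P(3)] P(3), of h]
        q_nonneg[OF L_diff[OF L_diff[OF DL P(3)] P(3)], of h] by simp
    moreover have "q (\<lambda>f. P (x + h) f - P x f) = h\<^sup>2 * q (?D h)"
      using q_scale[OF DL, of h h] h by simp
    ultimately show ?thesis
      using q_nonneg[OF DL, of h] by (simp add: abs_mult mult_left_mono)
    qed
    then show ?thesis by (simp add: eventually_at_filter)
  qed
qed

lemma has_real_derivative_r:
  assumes P: "has_qderiv P \<phi> x" "\<And>h. P h \<in> L" "\<phi> \<in> L"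
    and Q: "has_qderiv Q \<psi> x" "\<And>h. Q h \<in> L" "\<psi> \<in> L"
  shows "((\<lambda>x. r (P x) (Q x)) has_real_derivative r \<phi> (Q x) + r (P x) \<psi>) (at x)"
proof -
  let ?DP = "\<lambda>h f. (P (x + h) f - P x f) / h" and ?DQ = "\<lambda>h f. (Q (x + h) f - Q x f) / h"
  \<comment> \<open>At h = 0 division by zero makes the quotient the zero functional, so membership
    holds for every \<open>h\<close>, as \<open>tendsto_r\<close> demands.\<close>
  have DP: "?DP h \<in> L" for h
    using L_scale[OF L_diff[OF P(2)[of "x + h"] P(2)[of x]], of "1 / h"] by simp
  have DQ: "?DQ h \<in> L" for h
    using L_scale[OF L_diff[OF Q(2)[of "x + h"] Q(2)[of x]], of "1 / h"] by simp
  have "((\<lambda>h. r (?DP h) (Q (x + h)) + r (P x) (?DQ h)) \<longlongrightarrow> r \<phi> (Q x) + r (P x) \<psi>) (at 0)"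
    by (intro tendsto_add tendsto_r has_qderiv_imp_qlim[OF Q] qlim_const
        P(1)[unfolded has_qderiv_def] Q(1)[unfolded has_qderiv_def] DP DQ P Q)
  moreover have "r (?DP h) (Q (x + h)) + r (P x) (?DQ h) = (r (P (x + h)) (Q (x + h)) - r (P x) (Q x)) / h" for h
  proof -
    have "r (?DP h) (Q (x + h)) = (r (P (x + h)) (Q (x + h)) - r (P x) (Q (x + h))) / h"
      using r_scale_left[OF L_diff[OF P(2) P(2)] Q(2), of "1/h" "x+h" x "x+h"] P Q
      by (simp add: r_diff_left)
    moreover have "r (P x) (?DQ h) = (r (P x) (Q (x + h)) - r (P x) (Q x)) / h"
      using r_scale_right[OF L_diff[OF Q(2)[of "x + h"] Q(2)[of x]] P(2)[of x], of "1 / h"] P Q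
      by (simp add: r_diff_right)
    ultimately show ?thesis by (simp add: add_divide_distrib[symmetric])
  qed
  ultimately show ?thesis by (simp add: DERIV_def)
qed

end

subsection \<open>The Bergman space and its dual\<close>

lemma holo_const: "holo (\<lambda>z. c) D"
  by (simp add: holo_def)

lemma holo_linear:
  assumes L: "bounded_linear f" and c: "\<And>c v. f (cscale c v) = c * f v"
  shows "holo f D"
  unfolding holo_def
  using bounded_linear_imp_has_derivative[OF L, of "at _"] c
  by (metis differentiableI frechet_derivative_at)

lemma holo_nth: "holo (\<lambda>z. z $ j) D"
  by (rule holo_linear) (auto simp: bounded_linear_vec_nth cscale_def)

lemma holo_add:
  assumes "holo f D" "holo g D"
  shows "holo (\<lambda>z. f z + g z) D"
  unfolding holo_def
proof (intro ballI)
  fix z assume z: "z \<in> D"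
  note d = has_derivative_add[OF assms(1)[THEN holo_has_derivative, OF z] assms(2)[THEN holo_has_derivative, OF z]]
  show "(\<lambda>z. f z + g z) differentiable at z \<and>
    (\<forall>c v. frechet_derivative (\<lambda>z. f z + g z) (at z) (cscale c v) =
      c * frechet_derivative (\<lambda>z. f z + g z) (at z) v)"
    using assms z differentiableI[OF d]
    by (auto simp: frechet_derivative_at[OF d, symmetric] holo_def algebra_simps)
qed

lemma has_derivative_mult_holo:
  assumes "holo f D" "holo g D" "z \<in> D"
  shows "((\<lambda>z. f z * g z) has_derivative
     (\<lambda>h. f z * frechet_derivative g (at z) h + frechet_derivative f (at z) h * g z)) (at z)"
  using has_derivative_mult[OF assms(1)[THEN holo_has_derivative, OF assms(3)]
      assms(2)[THEN holo_has_derivative, OF assms(3)]] .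

lemma holo_mult:
  assumes "holo f D" "holo g D"
  shows "holo (\<lambda>z. f z * g z) D"
  unfolding holo_def
proof (intro ballI)
  fix z assume z: "z \<in> D"
  note d = has_derivative_mult_holo[OF assms z]
  show "(\<lambda>z. f z * g z) differentiable at z \<and>
    (\<forall>c v. frechet_derivative (\<lambda>z. f z * g z) (at z) (cscale c v) =
      c * frechet_derivative (\<lambda>z. f z * g z) (at z) v)"
    using assms z differentiableI[OF d]
    by (auto simp: frechet_derivative_at[OF d, symmetric] holo_def algebra_simps)
qed

text \<open>The arithmetic-geometric mean inequality, shaped to bound the supremum that defines
  \<open>q\<close>.\<close>

lemma square_le_mult_imp:
  fixes x C N :: real
  assumes "x\<^sup>2 \<le> C * N" "0 \<le> C" "0 \<le> N"
  shows "2 * x - N \<le> C"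
proof -
  have "(2 * x)\<^sup>2 \<le> 4 * (C * N)" using assms by (simp add: power_mult_distrib)
  also have "\<dots> = (C + N)\<^sup>2 - (C - N)\<^sup>2" by (simp add: power2_eq_square algebra_simps)
  also have "\<dots> \<le> (C + N)\<^sup>2" by simp
  finally have "2 * x \<le> C + N" using assms by (intro power2_le_imp_le[of "2 * x" "C + N"]) auto
  then show ?thesis by simp
qed

section \<open>The Bergman space of a bounded open set\<close>

locale bounded_open =
  fixes D :: "(complex^'n) set"
  assumes open_D: "open D" and bounded_D: "bounded D"
begin

definition I :: "(complex^'n \<Rightarrow> complex) \<Rightarrow> ennreal" where
  "I f = (\<integral>\<^sup>+w\<in>D. ennreal ((cmod (f w))\<^sup>2) \<partial>lborel)"

text \<open>\<open>enn2real\<close> sends infinity to 0, so this is the squared norm only on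
  \<open>A\<close>.\<close>

definition N :: "(complex^'n \<Rightarrow> complex) \<Rightarrow> real" where
  "N f = enn2real (I f)"

text \<open>The Bergman space, made of functions on the whole space whose values off
  \<open>D\<close> are arbitrary; \<open>N\<close> is therefore only a squared seminorm.\<close>

definition A :: "(complex^'n \<Rightarrow> complex) set" where
  "A = {f. holo f D \<and> I f < \<infinity>}"

lemma N_nonneg: "0 \<le> N f"
  by (simp add: N_def)

lemma I_eq_N: "f \<in> A \<Longrightarrow> I f = ennreal (N f)"
  by (simp add: A_def N_def)

lemma A_holo: "f \<in> A \<Longrightarrow> holo f D"
  by (simp add: A_def)

lemma I_scale:
  assumes "holo f D"
  shows "I (\<lambda>w. c * f w) = ennreal ((cmod c)\<^sup>2) * I f"
proof -
  have "I (\<lambda>w. c * f w) = (\<integral>\<^sup>+w. ennreal ((cmod c)\<^sup>2) * (ennreal ((cmod (f w))\<^sup>2) * indicator D w) \<partial>lborel)"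
    unfolding I_def by (simp add: norm_mult power_mult_distrib ennreal_mult mult.assoc)
  also have "\<dots> = ennreal ((cmod c)\<^sup>2) * I f"
    unfolding I_def using holo_square_measurable[OF assms open_D] by (intro nn_integral_cmult) simp
  finally show ?thesis .
qed

lemma A_scale: "f \<in> A \<Longrightarrow> (\<lambda>w. c * f w) \<in> A"
  using holo_mult[OF holo_const, of f D c] by (simp add: A_def I_scale ennreal_mult_less_top)

lemma N_scale: "f \<in> A \<Longrightarrow> N (\<lambda>w. c * f w) = (cmod c)\<^sup>2 * N f"
  by (simp add: N_def I_scale A_holo enn2real_mult)

lemma holo_diff: "holo f D \<Longrightarrow> holo g D \<Longrightarrow> holo (\<lambda>z. f z - g z) D"
  using holo_add[of f D "\<lambda>z. (-1) * g z"] holo_mult[OF holo_const, of g D "-1"] by simp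

lemma I_parallelogram:
  assumes f: "holo f D" and g: "holo g D"
  shows "I (\<lambda>w. f w + g w) + I (\<lambda>w. f w - g w) = 2 * I f + 2 * I g"
proof -
  let ?s = "\<lambda>f w. ennreal ((cmod (f w))\<^sup>2) * indicator D w"
  have m: "?s f \<in> borel_measurable lborel" if "holo f D" for f
    using holo_square_measurable[OF that open_D] by simp
  have "I (\<lambda>w. f w + g w) + I (\<lambda>w. f w - g w)
      = (\<integral>\<^sup>+w. ?s (\<lambda>w. f w + g w) w + ?s (\<lambda>w. f w - g w) w \<partial>lborel)"
    unfolding I_def by (rule nn_integral_add[symmetric]; rule m; intro holo_add holo_diff f g)
  also have "\<dots> = (\<integral>\<^sup>+w. 2 * ?s f w + 2 * ?s g w \<partial>lborel)"
  proof (rule nn_integral_cong)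
    fix w
    have "(cmod (f w + g w))\<^sup>2 + (cmod (f w - g w))\<^sup>2 = 2 * (cmod (f w))\<^sup>2 + 2 * (cmod (g w))\<^sup>2"
      unfolding cmod_power2 by (simp add: power2_eq_square algebra_simps)
    then have "ennreal ((cmod (f w + g w))\<^sup>2) + ennreal ((cmod (f w - g w))\<^sup>2)
        = 2 * ennreal ((cmod (f w))\<^sup>2) + 2 * ennreal ((cmod (g w))\<^sup>2)"
      by (metis ennreal_mult' ennreal_numeral ennreal_plus mult_nonneg_nonneg zero_le_numeral zero_le_power2)
    then show "?s (\<lambda>w. f w + g w) w + ?s (\<lambda>w. f w - g w) w = 2 * ?s f w + 2 * ?s g w"
      by (simp split: split_indicator)
  qed
  also have "\<dots> = 2 * I f + 2 * I g"
    unfolding I_def using m[OF f] m[OF g] by (simp add: nn_integral_add nn_integral_cmult)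
  finally show ?thesis .
qed

lemma A_add_diff:
  assumes "f \<in> A" "g \<in> A"
  shows A_add: "(\<lambda>w. f w + g w) \<in> A" and A_diff: "(\<lambda>w. f w - g w) \<in> A"
    and N_parallelogram: "N (\<lambda>w. f w + g w) + N (\<lambda>w. f w - g w) = 2 * N f + 2 * N g"
proof -
  have h: "holo f D" "holo g D" using assms by (auto simp: A_def)
  have fin: "2 * I f + 2 * I g < \<infinity>" using assms by (simp add: A_def ennreal_mult_less_top)
  note p = I_parallelogram[OF h]
  have "I (\<lambda>w. f w + g w) < \<infinity>" "I (\<lambda>w. f w - g w) < \<infinity>"
    using fin unfolding p[symmetric] by simp_all
  then show 1: "(\<lambda>w. f w + g w) \<in> A" "(\<lambda>w. f w - g w) \<in> A"
    using h by (auto simp: A_def holo_add holo_diff)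
  have "ennreal (N (\<lambda>w. f w + g w) + N (\<lambda>w. f w - g w)) = ennreal (2 * N f + 2 * N g)"
    using p by (simp add: N_nonneg ennreal_mult flip: I_eq_N[OF 1(1)] I_eq_N[OF 1(2)] I_eq_N[OF assms(1)] I_eq_N[OF assms(2)])
  then show "N (\<lambda>w. f w + g w) + N (\<lambda>w. f w - g w) = 2 * N f + 2 * N g"
    by (subst (asm) ennreal_inj) (simp_all add: N_nonneg)
qed

lemma bounded_holo_in_A:
  assumes "holo f D" "\<And>w. w \<in> D \<Longrightarrow> cmod (f w) \<le> B"
  shows "f \<in> A"
proof -
  have "I f \<le> (\<integral>\<^sup>+w. ennreal (B\<^sup>2) * indicator D w \<partial>lborel)"
    unfolding I_def using assms(2)
    by (intro nn_integral_mono) (auto split: split_indicator intro!: ennreal_leI power_mono)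
  also have "\<dots> = ennreal (B\<^sup>2) * emeasure lborel D"
    using open_D by (intro nn_integral_cmult_indicator) auto
  also have "\<dots> < \<infinity>"
    using emeasure_bounded_finite[OF bounded_D] by (simp add: ennreal_mult_less_top)
  finally show ?thesis using assms(1) by (simp add: A_def)
qed

lemma const_in_A: "(\<lambda>w. c) \<in> A"
  by (rule bounded_holo_in_A[OF holo_const, of _ "cmod c"]) simp

text \<open>The constant, a reciprocal ball volume, depends on the radius but not on
  \<open>w\<close>. This uniformity along a slice is what the Cauchy estimates start from.\<close>

lemma eval_bound:
  assumes f: "f \<in> A" and r: "0 < \<rho>" "ball w \<rho> \<subseteq> D"
  shows "(cmod (f w))\<^sup>2 \<le> (1 / measure lborel (ball (0::complex^'n) \<rho>)) * N f"
proof -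
  have pos: "0 < measure lborel (ball (0::complex^'n) \<rho>)" using content_ball_pos[OF r(1)] by simp
  have "ennreal ((cmod (f w))\<^sup>2 * measure lborel (ball (0::complex^'n) \<rho>))
      = ennreal ((cmod (f w))\<^sup>2) * emeasure lborel (ball (0::complex^'n) \<rho>)"
    using emeasure_bounded_finite[OF bounded_ball, of "0::complex^'n" \<rho>]
    by (simp add: ennreal_mult emeasure_eq_ennreal_measure)
  also have "\<dots> \<le> ennreal (N f)"
    using holo_sub_mean_value[OF A_holo[OF f] open_D r(2)] I_eq_N[OF f] by (simp add: I_def)
  finally have "(cmod (f w))\<^sup>2 * measure lborel (ball (0::complex^'n) \<rho>) \<le> N f"
    by (simp add: N_nonneg)
  then show ?thesis using pos by (simp add: field_simps)
qed

text \<open>\<open>L\<close> is the real dual of the Bergman space, and \<open>q\<close> the squared dual norm.\<close>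

definition L :: "((complex^'n \<Rightarrow> complex) \<Rightarrow> real) set" where
  "L = {\<phi>. (\<forall>f\<in>A. \<forall>g\<in>A. \<phi> (\<lambda>w. f w + g w) = \<phi> f + \<phi> g) \<and>
       (\<forall>f\<in>A. \<forall>c. \<phi> (\<lambda>w. of_real c * f w) = c * \<phi> f) \<and>
       (\<exists>C\<ge>0. \<forall>f\<in>A. (\<phi> f)\<^sup>2 \<le> C * N f)}"

definition q :: "((complex^'n \<Rightarrow> complex) \<Rightarrow> real) \<Rightarrow> real" where
  "q \<phi> = (SUP f\<in>A. 2 * \<phi> f - N f)"

lemma LI:
  assumes "\<And>f g. f \<in> A \<Longrightarrow> g \<in> A \<Longrightarrow> \<phi> (\<lambda>w. f w + g w) = \<phi> f + \<phi> g"
    and "\<And>f c. f \<in> A \<Longrightarrow> \<phi> (\<lambda>w. of_real c * f w) = c * \<phi> f"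
    and "0 \<le> C" "\<And>f. f \<in> A \<Longrightarrow> (\<phi> f)\<^sup>2 \<le> C * N f"
  shows "\<phi> \<in> L"
  using assms unfolding L_def by blast

lemma L_lin:
  assumes "\<phi> \<in> L" "f \<in> A"
  shows "g \<in> A \<Longrightarrow> \<phi> (\<lambda>w. f w + g w) = \<phi> f + \<phi> g" "\<phi> (\<lambda>w. of_real c * f w) = c * \<phi> f"
  using assms unfolding L_def by auto

lemma L_lin_diff:
  assumes "\<phi> \<in> L" "f \<in> A" "g \<in> A"
  shows "\<phi> (\<lambda>w. f w - g w) = \<phi> f - \<phi> g"
  using L_lin(1)[OF assms(1,2) A_scale[OF assms(3), of "-1"]] L_lin(2)[OF assms(1,3), of "-1"] by simp

lemma q_least:
  assumes "\<And>f. f \<in> A \<Longrightarrow> 2 * \<phi> f - N f \<le> M"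
  shows "q \<phi> \<le> M"
  unfolding q_def using const_in_A assms by (intro cSUP_least) auto

lemma q_le:
  assumes "0 \<le> C" "\<And>f. f \<in> A \<Longrightarrow> (\<phi> f)\<^sup>2 \<le> C * N f"
  shows "q \<phi> \<le> C"
  using assms square_le_mult_imp N_nonneg by (intro q_least) blast

lemma q_upper:
  assumes "\<phi> \<in> L" "f \<in> A"
  shows "2 * \<phi> f - N f \<le> q \<phi>"
proof -
  obtain C where "0 \<le> C" "\<forall>f\<in>A. (\<phi> f)\<^sup>2 \<le> C * N f" using assms(1) unfolding L_def by blast
  then have "bdd_above ((\<lambda>f. 2 * \<phi> f - N f) ` A)"
    using square_le_mult_imp N_nonneg by (intro bdd_aboveI2[of _ _ C]) blast
  then show ?thesis unfolding q_def using assms(2) by (rule cSUP_upper2) simp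
qed

text \<open>Converse of \<open>q_le\<close>: apply \<open>q_upper\<close> to real multiples
  \<open>t\<close> of \<open>f\<close> and optimize. The best choice is
  \<open>\<phi> f / N f\<close>; if \<open>N f = 0\<close> the bound is linear in \<open>t\<close>
  and forces \<open>\<phi> f = 0\<close>.\<close>

lemma square_le_q:
  assumes "\<phi> \<in> L" "f \<in> A"
  shows "(\<phi> f)\<^sup>2 \<le> q \<phi> * N f"
proof -
  have t: "2 * (t * \<phi> f) - t\<^sup>2 * N f \<le> q \<phi>" for t
    using q_upper[OF assms(1) A_scale[OF assms(2), of "of_real t"]] L_lin(2)[OF assms, of t]
    by (simp add: N_scale[OF assms(2)])
  show ?thesis
  proof (cases "N f = 0")
    case True
    have "\<phi> f = 0"
    proof (rule ccontr)
      assume "\<phi> f \<noteq> 0"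
      then have "2 * ((q \<phi> + 1) / (2 * \<phi> f) * \<phi> f) = q \<phi> + 1" by simp
      then show False using t[of "(q \<phi> + 1) / (2 * \<phi> f)"] True by simp
    qed
    then show ?thesis using True by simp
  next
    case False
    then have "0 < N f" using N_nonneg[of f] by simp
    then show ?thesis using t[of "\<phi> f / N f"] by (simp add: field_simps power2_eq_square)
  qed
qed

lemma q_pos:
  assumes "\<phi> \<in> L" "f \<in> A" "\<phi> f \<noteq> 0"
  shows "0 < q \<phi>"
proof -
  have "0 < q \<phi> * N f" using square_le_q[OF assms(1,2)] assms(3) by (meson less_le_trans zero_less_power2)
  then show ?thesis using N_nonneg[of f] by (simp add: zero_less_mult_iff)
qed

lemma q_scale_le:
  assumes "\<phi> \<in> L" "c \<noteq> 0"
  shows "q (\<lambda>f. c * \<phi> f) \<le> c\<^sup>2 * q \<phi>"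
proof (rule q_least)
  fix f assume f: "f \<in> A"
  let ?f = "\<lambda>w. of_real (1 / c) * f w"
  have "c\<^sup>2 * (2 * \<phi> ?f - N ?f) \<le> c\<^sup>2 * q \<phi>"
    by (intro mult_left_mono q_upper assms A_scale f) simp
  moreover have "c\<^sup>2 * (2 * \<phi> ?f - N ?f) = 2 * (c * \<phi> f) - N f"
    using assms(2) unfolding L_lin(2)[OF assms(1) f] N_scale[OF f] norm_of_real
    by (simp add: field_simps power2_eq_square)
  ultimately show "2 * (c * \<phi> f) - N f \<le> c\<^sup>2 * q \<phi>" by simp
qed

lemma q_nonneg':
  assumes "\<phi> \<in> L"
  shows "0 \<le> q \<phi>"
  using q_upper[OF assms const_in_A[of 0]] L_lin(2)[OF assms const_in_A[of 0], of 0]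
    N_scale[OF const_in_A[of 0], of 0] by simp

lemma L_scale': "\<phi> \<in> L \<Longrightarrow> (\<lambda>f. c * \<phi> f) \<in> L"
proof -
  assume L: "\<phi> \<in> L"
  show ?thesis
  proof (rule LI)
    show "0 \<le> c\<^sup>2 * q \<phi>" using q_nonneg'[OF L] by simp
    show "(c * \<phi> f)\<^sup>2 \<le> c\<^sup>2 * q \<phi> * N f" if "f \<in> A" for f
      using mult_left_mono[OF square_le_q[OF L that], of "c\<^sup>2"] by (simp add: power_mult_distrib mult.assoc)
  qed (use L_lin[OF L] in \<open>simp_all add: algebra_simps\<close>)
qed


lemma L_add':
  assumes "\<phi> \<in> L" "\<psi> \<in> L"
  shows "(\<lambda>f. \<phi> f + \<psi> f) \<in> L"
proof (rule LI)
  show "0 \<le> 2 * q \<phi> + 2 * q \<psi>" using assms by (simp add: q_nonneg')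
  show "(\<phi> f + \<psi> f)\<^sup>2 \<le> (2 * q \<phi> + 2 * q \<psi>) * N f" if f: "f \<in> A" for f
  proof -
    have "(\<phi> f + \<psi> f)\<^sup>2 \<le> 2 * (\<phi> f)\<^sup>2 + 2 * (\<psi> f)\<^sup>2"
      using zero_le_power2[of "\<phi> f - \<psi> f"] by (simp add: power2_eq_square algebra_simps)
    then show ?thesis
      using square_le_q[OF assms(1) f] square_le_q[OF assms(2) f] by (simp add: algebra_simps)
  qed
qed (use assms L_lin in \<open>simp_all add: algebra_simps\<close>)

lemma L_diff': "\<phi> \<in> L \<Longrightarrow> \<psi> \<in> L \<Longrightarrow> (\<lambda>f. \<phi> f - \<psi> f) \<in> L"
  using L_add'[of \<phi> "\<lambda>f. (-1) * \<psi> f"] L_scale'[of \<psi> "-1"] by simp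

lemma q_scale':
  assumes "\<phi> \<in> L"
  shows "q (\<lambda>f. c * \<phi> f) = c\<^sup>2 * q \<phi>"
proof (cases "c = 0")
  case True
  have "q (\<lambda>f. 0 * \<phi> f) \<le> 0" by (rule q_le) (auto simp: N_nonneg)
  then show ?thesis using q_nonneg'[OF L_scale'[OF assms, of 0]] True by simp
next
  case False
  have "q \<phi> = q (\<lambda>f. (1 / c) * (c * \<phi> f))" using False by simp
  also have "\<dots> \<le> (1 / c)\<^sup>2 * q (\<lambda>f. c * \<phi> f)"
    using False by (intro q_scale_le L_scale' assms) simp
  finally have "c\<^sup>2 * q \<phi> \<le> q (\<lambda>f. c * \<phi> f)" using False by (simp add: field_simps)
  then show ?thesis using q_scale_le[OF assms False] by simp
qed

text \<open>The Legendre transform \<open>q\<close> of the quadratic form \<open>N\<close> inherits the parallelogram law by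
  the substitution \<open>s = (f + g) / 2\<close>, \<open>t = (f - g) / 2\<close>; completeness of the Bergman space is
  not needed.\<close>

lemma q_parallelogram_le:
  assumes L: "\<phi> \<in> L" "\<psi> \<in> L"
  shows "q (\<lambda>f. \<phi> f + \<psi> f) + q (\<lambda>f. \<phi> f - \<psi> f) \<le> 2 * q \<phi> + 2 * q \<psi>"
proof -
  let ?M = "2 * q \<phi> + 2 * q \<psi>"
  have *: "(2 * (\<phi> f + \<psi> f) - N f) + (2 * (\<phi> g - \<psi> g) - N g) \<le> ?M"
    if f: "f \<in> A" and g: "g \<in> A" for f g
  proof -
    let ?s = "\<lambda>w. of_real (1 / 2) * (f w + g w)" and ?t = "\<lambda>w. of_real (1 / 2) * (f w - g w)"
    note fg = A_add[OF f g] A_diff[OF f g]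
    have "\<phi> ?s = (\<phi> f + \<phi> g) / 2"
      unfolding L_lin(2)[OF L(1) fg(1)] L_lin(1)[OF L(1) f g] by simp
    moreover have "\<psi> ?t = (\<psi> f - \<psi> g) / 2"
      unfolding L_lin(2)[OF L(2) fg(2)] L_lin_diff[OF L(2) f g] by simp
    moreover have "N ?s = N (\<lambda>w. f w + g w) / 4" "N ?t = N (\<lambda>w. f w - g w) / 4"
      unfolding N_scale[OF fg(1)] N_scale[OF fg(2)] by (simp_all add: power2_eq_square norm_divide)
    moreover have "2 * \<phi> ?s - N ?s \<le> q \<phi>" "2 * \<psi> ?t - N ?t \<le> q \<psi>"
      by (intro q_upper L A_scale fg)+
    ultimately show ?thesis using N_parallelogram[OF f g] by (simp add: field_simps)
  qed
  have "q (\<lambda>f. \<phi> f - \<psi> f) \<le> ?M - q (\<lambda>f. \<phi> f + \<psi> f)"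
  proof (rule q_least)
    fix g assume g: "g \<in> A"
    have "q (\<lambda>f. \<phi> f + \<psi> f) \<le> ?M - (2 * (\<phi> g - \<psi> g) - N g)"
      by (rule q_least) (use *[OF _ g] in \<open>simp add: algebra_simps\<close>)
    then show "2 * (\<phi> g - \<psi> g) - N g \<le> ?M - q (\<lambda>f. \<phi> f + \<psi> f)" by simp
  qed
  then show ?thesis by simp
qed

sublocale parallelogram_form L q
proof
  show "(\<lambda>f. \<phi> f + \<psi> f) \<in> L" if "\<phi> \<in> L" "\<psi> \<in> L" for \<phi> \<psi> using that by (rule L_add')
  show "(\<lambda>f. c * \<phi> f) \<in> L" if "\<phi> \<in> L" for \<phi> c using that by (rule L_scale')
  show "0 \<le> q \<phi>" if "\<phi> \<in> L" for \<phi> using that by (rule q_nonneg')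
  show "q (\<lambda>f. c * \<phi> f) = c\<^sup>2 * q \<phi>" if "\<phi> \<in> L" for \<phi> c using that by (rule q_scale')
  fix \<phi> \<psi> assume L: "\<phi> \<in> L" "\<psi> \<in> L"
  \<comment> \<open>The reverse inequality is the proved one for \<phi> + \<psi> and \<phi> -
    \<psi>, whose sum and difference are 2 \<phi> and 2 \<psi>.\<close>
  have "q (\<lambda>f. 2 * \<phi> f) + q (\<lambda>f. 2 * \<psi> f) \<le> 2 * q (\<lambda>f. \<phi> f + \<psi> f) + 2 * q (\<lambda>f. \<phi> f - \<psi> f)"
    using q_parallelogram_le[OF L_add'[OF L] L_diff'[OF L]] by simp
  then show "q (\<lambda>f. \<phi> f + \<psi> f) + q (\<lambda>f. \<phi> f - \<psi> f) = 2 * q \<phi> + 2 * q \<psi>"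
    using q_parallelogram_le[OF L] q_scale'[OF L(1), of 2] q_scale'[OF L(2), of 2] by simp
qed

section \<open>Point evaluations and the kernel on the diagonal\<close>

lemma eval_in_L:
  assumes "w \<in> D"
  shows "(\<lambda>f. Re (f w)) \<in> L"
proof -
  obtain \<rho> where r: "0 < \<rho>" "ball w \<rho> \<subseteq> D" using open_D assms openE by blast
  show ?thesis
  proof (rule LI)
    show "(Re (f w))\<^sup>2 \<le> (1 / measure lborel (ball (0::complex^'n) \<rho>)) * N f" if "f \<in> A" for f
      using order_trans[OF _ eval_bound[OF that r]] by (simp add: cmod_power2)
  qed auto
qed

text \<open>The kernel maximizes the modulus on the unit ball, while \<open>q\<close> sees only real
  parts; rotating \<open>f\<close> until \<open>f w\<close> is real and nonnegative bridges the two.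
  Conversely \<open>f\<close> is normalized, and if \<open>N f = 0\<close> then
  \<open>eval_bound\<close> gives \<open>f w = 0\<close>.\<close>

lemma kernel_eq_q:
  assumes w: "w \<in> D"
  shows "bergman_kernel_diag D w = q (\<lambda>f. Re (f w))"
proof (rule antisym)
  let ?S = "{(cmod (f w))\<^sup>2 | f. holo f D \<and> I f \<le> 1}"
  let ?e = "\<lambda>f :: complex^'n \<Rightarrow> complex. Re (f w)"
  note L = eval_in_L[OF w]
  have K: "bergman_kernel_diag D w = Sup ?S" by (simp add: bergman_kernel_diag_def I_def)
  have up: "x \<le> q ?e" if xS: "x \<in> ?S" for x
  proof -
    obtain f where x: "x = (cmod (f w))\<^sup>2" and f: "holo f D" "I f \<le> 1" using xS by blast
    have fA: "f \<in> A" using f by (auto simp: A_def intro: le_less_trans)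
    have N1: "N f \<le> 1" using f(2) by (simp add: I_eq_N[OF fA])
    \<comment> \<open>Unimodular, or 0 when \<open>f w = 0\<close>; in both cases the factor does
      not increase \<open>N\<close>.\<close>
    let ?u = "cnj (sgn (f w))"
    have "?u * f w = of_real (cmod (f w))"
      by (cases "f w = 0") (simp_all add: sgn_eq complex_norm_square[symmetric] mult.commute power2_eq_square)
    then have "(cmod (f w))\<^sup>2 = (Re (?u * f w))\<^sup>2" by simp
    also have "\<dots> \<le> q ?e * N (\<lambda>w'. ?u * f w')" by (rule square_le_q[OF L A_scale[OF fA]])
    also have "\<dots> \<le> q ?e * 1"
    proof (rule mult_left_mono[OF _ q_nonneg[OF L]])
      have "(cmod ?u)\<^sup>2 * N f \<le> 1 * 1" using N1 N_nonneg by (intro mult_mono) (auto simp: norm_sgn)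
      then show "N (\<lambda>w'. ?u * f w') \<le> 1" by (simp add: N_scale[OF fA])
    qed
    finally show ?thesis by (simp add: x)
  qed
  have ne: "0 \<in> ?S" using holo_const[of 0 D] by (force simp: I_def)
  show "bergman_kernel_diag D w \<le> q ?e"
    unfolding K using ne up by (intro cSup_least) auto
  have bdd: "bdd_above ?S" using up by (rule bdd_aboveI)
  have K0: "0 \<le> Sup ?S" using ne bdd by (rule cSup_upper)
  show "q ?e \<le> bergman_kernel_diag D w"
    unfolding K
  proof (rule q_le[OF K0])
    fix f assume f: "f \<in> A"
    have "(cmod (f w))\<^sup>2 \<le> Sup ?S * N f"
    proof (cases "N f = 0")
      case True
      obtain \<rho> where "0 < \<rho>" "ball w \<rho> \<subseteq> D" using open_D assms openE by blast
      from eval_bound[OF f this] show ?thesis using True by simp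
    next
      case False
      then have pos: "0 < N f" using N_nonneg[of f] by simp
      let ?c = "of_real (1 / sqrt (N f)) :: complex"
      have fA: "(\<lambda>w. ?c * f w) \<in> A" by (rule A_scale[OF f])
      have "N (\<lambda>w. ?c * f w) = 1" unfolding N_scale[OF f] using pos by (simp add: norm_divide power_divide)
      then have "I (\<lambda>w. ?c * f w) \<le> 1" unfolding I_eq_N[OF fA] by simp
      then have "(cmod (?c * f w))\<^sup>2 \<in> ?S"
        using A_holo[OF fA] by (intro CollectI exI[of _ "\<lambda>w. ?c * f w"]) simp
      then have "(cmod (?c * f w))\<^sup>2 \<le> Sup ?S" using bdd by (rule cSup_upper)
      then show ?thesis using pos by (simp add: norm_mult norm_divide power_divide power_mult_distrib field_simps)
    qed
    then show "(Re (f w))\<^sup>2 \<le> Sup ?S * N f"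
      using order_trans[of "(Re (f w))\<^sup>2" "(cmod (f w))\<^sup>2"] by (simp add: cmod_power2)
  qed
qed

end

subsection \<open>Positivity of the Bergman metric\<close>

text \<open>The inner \<open>deriv\<close> must be identified on a neighbourhood of 0 before the
  outer one can be computed, hence first derivatives on an interval.\<close>

lemma deriv_deriv_ln:
  fixes k k' :: "real \<Rightarrow> real"
  assumes d: "0 < d" and pos: "\<And>x. \<bar>x\<bar> < d \<Longrightarrow> 0 < k x"
    and k: "\<And>x. \<bar>x\<bar> < d \<Longrightarrow> (k has_real_derivative k' x) (at x)"
    and k': "(k' has_real_derivative k2) (at 0)"
  shows "deriv (\<lambda>x. deriv (\<lambda>y. ln (k y)) x) 0 = k2 / k 0 - (k' 0 / k 0)\<^sup>2"
proof -
  have 1: "deriv (\<lambda>y. ln (k y)) x = k' x / k x" if "x \<in> ball 0 d" for x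
    using that pos k by (intro DERIV_imp_deriv) (auto intro!: derivative_eq_intros)
  have "((\<lambda>x. k' x / k x) has_real_derivative (k2 * k 0 - k' 0 * k' 0) / (k 0 * k 0)) (at 0)"
    using k' k[of 0] pos[of 0] d by (intro DERIV_divide) auto
  then have "((\<lambda>x. deriv (\<lambda>y. ln (k y)) x) has_real_derivative (k2 * k 0 - k' 0 * k' 0) / (k 0 * k 0)) (at 0)"
    by (rule has_field_derivative_transform_within_open[where S = "ball 0 d"]) (use d 1 in auto)
  then have "deriv (\<lambda>x. deriv (\<lambda>y. ln (k y)) x) 0 = (k2 * k 0 - k' 0 * k' 0) / (k 0 * k 0)"
    by (rule DERIV_imp_deriv)
  also have "\<dots> = k2 / k 0 - (k' 0 / k 0)\<^sup>2"
    using pos[of 0] d by (simp add: field_simps power2_eq_square)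
  finally show ?thesis .
qed

section \<open>Evaluation along a complex line as a smooth curve in the dual\<close>

locale slice_disc = bounded_open D for D :: "(complex^'n) set" +
  fixes z v :: "complex^'n" and \<rho> d :: real
  assumes rho: "0 < \<rho>" and d: "0 < d"
    and sub: "\<And>\<zeta>. cmod \<zeta> < 2 * d \<Longrightarrow> ball (z + cscale \<zeta> v) \<rho> \<subseteq> D"
begin

definition F :: "(complex^'n \<Rightarrow> complex) \<Rightarrow> complex \<Rightarrow> complex" where
  "F f \<zeta> = f (z + cscale \<zeta> v)"

definition C :: real where
  "C = 1 / measure lborel (ball (0::complex^'n) \<rho>)"

text \<open>The candidate \<open>k\<close>-th derivative of the curve of evaluations. The cutoff to
  0 outside the interval keeps it in \<open>L\<close> for every \<open>x\<close>, as the calculus of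
  curves assumes.\<close>

definition E :: "nat \<Rightarrow> real \<Rightarrow> (complex^'n \<Rightarrow> complex) \<Rightarrow> real" where
  "E k x f = (if \<bar>x\<bar> < d then Re ((deriv ^^ k) (F f) (of_real x)) else 0)"

lemma C_nonneg: "0 \<le> C"
  by (simp add: C_def)

lemma F_in_D: "cmod \<zeta> < 2 * d \<Longrightarrow> z + cscale \<zeta> v \<in> D"
  using sub[of \<zeta>] rho by auto

lemma F_holomorphic: "f \<in> A \<Longrightarrow> F f holomorphic_on ball 0 (2 * d)"
  unfolding F_def [abs_def] using F_in_D by (intro holo_slice_holomorphic[OF A_holo]) auto

lemma F_bound:
  assumes "f \<in> A" "cmod \<zeta> < 2 * d"
  shows "cmod (F f \<zeta>) \<le> sqrt (C * N f)"
  using eval_bound[OF assms(1) rho sub[OF assms(2)]] by (intro real_le_rsqrt) (simp add: F_def C_def)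

text \<open>Cauchy's inequality on circles of radius \<open>d\<close> about points of modulus below
  \<open>d\<close>, which is why the locale asks for a disc of radius \<open>2 * d\<close>.
  Proportionality to \<open>sqrt (C * N f)\<close> makes each derivative a bounded functional of
  \<open>f\<close>.\<close>

lemma higher_deriv_F_bound:
  assumes f: "f \<in> A" and \<zeta>: "cmod \<zeta> < d"
  shows "cmod ((deriv ^^ n) (F f) \<zeta>) \<le> fact n * sqrt (C * N f) / d ^ n"
proof (rule Cauchy_inequality)
  have sub: "cball \<zeta> d \<subseteq> ball 0 (2 * d)"
  proof
    fix w assume "w \<in> cball \<zeta> d"
    then have "cmod (w - \<zeta>) \<le> d" by (simp add: dist_norm norm_minus_commute)
    then show "w \<in> ball 0 (2 * d)" using norm_triangle_ineq[of \<zeta> "w - \<zeta>"] \<zeta> by simp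
  qed
  show "F f holomorphic_on ball \<zeta> d"
    using sub by (intro holomorphic_on_subset[OF F_holomorphic[OF f]]) auto
  show "continuous_on (cball \<zeta> d) (F f)"
    using holomorphic_on_imp_continuous_on[OF F_holomorphic[OF f]] sub by (rule continuous_on_subset)
  show "cmod (F f x) \<le> sqrt (C * N f)" if "cmod (\<zeta> - x) = d" for x
    using sub that by (intro F_bound[OF f]) (auto simp: subset_eq dist_norm)
qed (rule d)

lemma E_in_L: "E k x \<in> L"
proof (rule LI)
  show "0 \<le> (fact k / d ^ k)\<^sup>2 * C" using C_nonneg by simp
  fix f assume f: "f \<in> A"
  have x: "of_real x \<in> ball (0::complex) (2 * d)" if "\<bar>x\<bar> < d" using that d by simp
  show "(E k x f)\<^sup>2 \<le> (fact k / d ^ k)\<^sup>2 * C * N f"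
  proof (cases "\<bar>x\<bar> < d")
    case True
    have "\<bar>Re ((deriv ^^ k) (F f) (of_real x))\<bar> \<le> fact k / d ^ k * sqrt (C * N f)"
      using order_trans[OF abs_Re_le_cmod higher_deriv_F_bound[OF f]] True by simp
    then have "(Re ((deriv ^^ k) (F f) (of_real x)))\<^sup>2 \<le> (fact k / d ^ k * sqrt (C * N f))\<^sup>2"
      by (rule abs_le_square_iff[THEN iffD1, OF order_trans[OF _ abs_ge_self]])
    then show ?thesis using True C_nonneg N_nonneg by (simp add: E_def power_mult_distrib power_divide mult.assoc)
  qed (use C_nonneg N_nonneg in \<open>simp add: E_def\<close>)
  show "E k x (\<lambda>w. f w + g w) = E k x f + E k x g" if g: "g \<in> A" for g
    using higher_deriv_add[OF F_holomorphic[OF f] F_holomorphic[OF g] open_ball x]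
    by (simp add: E_def F_def[abs_def])
  show "E k x (\<lambda>w. of_real c * f w) = c * E k x f" for c
    using higher_deriv_cmult[OF F_holomorphic[OF f] x open_ball]
    by (simp add: E_def F_def[abs_def])
qed

text \<open>Taylor's formula to first order, for each \<open>f\<close>, with the remainder
  controlled by the derivative of order \<open>k + 2\<close>. The error of the difference quotient
  is at most \<open>B * \<bar>h\<bar>\<close>, where the square of \<open>B\<close> is
  \<open>M * N f\<close>; \<open>q_le\<close> turns this into an estimate uniform in
  \<open>f\<close>.\<close>

lemma E_has_qderiv:
  assumes x: "\<bar>x\<bar> < d"
  shows "has_qderiv (E k) (E (Suc k) x) x"
  unfolding has_qderiv_def qlim_def
proof (rule Lim_null_comparison)
  define M where "M = (fact (k + 2) / d ^ (k + 2))\<^sup>2 * C"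
  have M0: "0 \<le> M" using C_nonneg by (simp add: M_def)
  show "((\<lambda>h. M * h\<^sup>2) \<longlongrightarrow> 0) (at 0)" by (auto intro!: tendsto_eq_intros)
  let ?\<Delta> = "\<lambda>h f. (E k (x + h) f - E k x f) / h - E (Suc k) x f"
  have "norm (q (?\<Delta> h)) \<le> M * h\<^sup>2" if h: "h \<noteq> 0" "\<bar>h\<bar> < d - \<bar>x\<bar>" for h
  proof -
    have xh: "\<bar>x + h\<bar> < d" using h by linarith
    have "(?\<Delta> h f)\<^sup>2 \<le> M * h\<^sup>2 * N f" if f: "f \<in> A" for f
    proof -
      define B where "B = fact (k + 2) * sqrt (C * N f) / d ^ (k + 2)"
      have B0: "0 \<le> B" using d C_nonneg N_nonneg by (simp add: B_def)
      let ?G = "\<lambda>i. (deriv ^^ (k + i)) (F f)"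
      let ?R = "?G 0 (of_real (x + h)) - (\<Sum>i\<le>1. ?G i (of_real x) * (of_real (x + h) - of_real x) ^ i / fact i)"
      have "cmod ?R \<le> B * cmod (of_real (x + h) - of_real x) ^ Suc 1 / fact 1"
      proof (rule complex_Taylor[where S = "ball 0 d"])
        show "(?G i has_field_derivative ?G (Suc i) \<zeta>) (at \<zeta> within ball 0 d)"
          if "\<zeta> \<in> ball 0 d" for i \<zeta>
        proof -
          have "?G i holomorphic_on ball 0 (2 * d)"
            by (intro holomorphic_higher_deriv F_holomorphic f) simp
          then have "(?G i has_field_derivative deriv (?G i) \<zeta>) (at \<zeta>)"
            using that d by (intro holomorphic_derivI[of _ "ball 0 (2 * d)"]) auto
          then show ?thesis by (simp add: has_field_derivative_at_within)
        qed
        show "cmod (?G (Suc 1) \<zeta>) \<le> B" if "\<zeta> \<in> ball 0 d" for \<zeta>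
          using higher_deriv_F_bound[OF f, of \<zeta> "k + 2"] that by (simp add: B_def)
      qed (use x xh in \<open>auto simp del: of_real_add\<close>)
      then have R: "cmod ?R \<le> B * h\<^sup>2" by (simp add: power2_eq_square)
      have "?\<Delta> h f = Re ?R / h"
        using x xh h by (simp add: E_def field_simps)
      then have "\<bar>?\<Delta> h f\<bar> \<le> B * h\<^sup>2 / \<bar>h\<bar>"
        using order_trans[OF abs_Re_le_cmod R] by (simp add: divide_right_mono)
      also have "\<dots> = B * \<bar>h\<bar>" using h by (simp add: power2_eq_square field_simps)
      finally have "(?\<Delta> h f)\<^sup>2 \<le> (B * \<bar>h\<bar>)\<^sup>2"
        by (rule abs_le_square_iff[THEN iffD1, OF order_trans[OF _ abs_ge_self]])
      also have "\<dots> = M * h\<^sup>2 * N f"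
        using C_nonneg N_nonneg by (simp add: B_def M_def power_mult_distrib power_divide)
      finally show ?thesis .
    qed
    then have "q (?\<Delta> h) \<le> M * h\<^sup>2" using M0 by (intro q_le) auto
    moreover have "?\<Delta> h \<in> L"
      using L_diff[OF L_scale[OF L_diff[OF E_in_L[of k "x + h"] E_in_L[of k x]], of "1 / h"] E_in_L[of "Suc k" x]]
      by simp
    ultimately show ?thesis using q_nonneg by simp
  qed
  moreover have "\<forall>\<^sub>F h in at 0. h \<noteq> 0 \<and> \<bar>h\<bar> < d - \<bar>x\<bar>"
    using x by (auto simp: eventually_at intro!: exI[of _ "d - \<bar>x\<bar>"])
  ultimately show "\<forall>\<^sub>F h in at 0. norm (q (?\<Delta> h)) \<le> M * h\<^sup>2"
    by (auto elim!: eventually_mono)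
qed

definition k' :: "real \<Rightarrow> real" where
  "k' x = 2 * r (E 0 x) (E 1 x)"

lemma kernel_slice:
  assumes "\<bar>x\<bar> < d"
  shows "bergman_kernel_diag D (z + cscale (of_real x) v) = q (E 0 x)"
proof -
  have "E 0 x = (\<lambda>f. Re (f (z + cscale (of_real x) v)))"
    using assms by (simp add: E_def F_def fun_eq_iff)
  then show ?thesis using kernel_eq_q[OF F_in_D, of "of_real x"] assms d by simp
qed

lemma kernel_slice_pos:
  assumes "\<bar>x\<bar> < d"
  shows "0 < bergman_kernel_diag D (z + cscale (of_real x) v)"
  unfolding kernel_slice[OF assms]
  by (rule q_pos[OF E_in_L const_in_A[of 1]]) (simp add: E_def F_def assms)

lemma kernel_slice_deriv:
  assumes x: "\<bar>x\<bar> < d"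
  shows "((\<lambda>x. bergman_kernel_diag D (z + cscale (of_real x) v)) has_real_derivative k' x) (at x)"
proof (rule has_field_derivative_transform_within_open[where S = "ball 0 d"])
  show "((\<lambda>x. r (E 0 x) (E 0 x)) has_real_derivative k' x) (at x)"
    using has_real_derivative_r[OF E_has_qderiv[OF x, of 0] E_in_L E_in_L E_has_qderiv[OF x, of 0] E_in_L E_in_L]
      r_commute[OF E_in_L E_in_L, of 0 x 1 x] by (simp add: k'_def)
qed (use x in \<open>auto simp: kernel_slice r_self E_in_L\<close>)

lemma kernel_slice_deriv2:
  "(k' has_real_derivative 2 * q (E 1 0) + 2 * r (E 0 0) (E 2 0)) (at 0)"
proof -
  have "\<bar>0::real\<bar> < d" using d by simp
  note D = E_has_qderiv[OF this]
  have "((\<lambda>x. 2 * r (E 0 x) (E 1 x)) has_real_derivative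
      2 * (r (E 1 0) (E 1 0) + r (E 0 0) (E 2 0))) (at 0)"
    using DERIV_cmult[OF has_real_derivative_r[OF D[of 0] E_in_L E_in_L D[of 1] E_in_L E_in_L], of 2]
    by (simp add: numeral_2_eq_2)
  then show ?thesis by (simp add: k'_def[abs_def] r_self[OF E_in_L])
qed

lemma deriv_deriv_ln_kernel_slice:
  "deriv (\<lambda>x. deriv (\<lambda>y. ln (bergman_kernel_diag D (z + cscale (of_real y) v))) x) 0
    = (2 * q (E 1 0) + 2 * r (E 0 0) (E 2 0)) / q (E 0 0) - (2 * r (E 0 0) (E 1 0) / q (E 0 0))\<^sup>2"
  using deriv_deriv_ln[OF d kernel_slice_pos kernel_slice_deriv kernel_slice_deriv2]
    kernel_slice[of 0] d by (simp add: k'_def)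

end

section \<open>Multiplication by i and the Levi form\<close>

context bounded_open
begin

text \<open>Multiplication by i maps \<open>A\<close> onto itself and preserves \<open>N\<close>, so
  it only permutes the values in the supremum. This equips the real dual with a complex
  structure.\<close>

lemma q_compose_ii: "q (\<lambda>f. \<phi> (\<lambda>w. \<i> * f w)) = q \<phi>"
proof -
  have "(\<lambda>f. 2 * \<phi> (\<lambda>w. \<i> * f w) - N f) ` A = (\<lambda>f. 2 * \<phi> f - N f) ` A"
  proof (intro subset_antisym image_subsetI)
    fix f assume f: "f \<in> A"
    show "2 * \<phi> (\<lambda>w. \<i> * f w) - N f \<in> (\<lambda>f. 2 * \<phi> f - N f) ` A"
      using N_scale[OF f, of \<i>] by (intro image_eqI[OF _ A_scale[OF f, of \<i>]]) simp
    show "2 * \<phi> f - N f \<in> (\<lambda>f. 2 * \<phi> (\<lambda>w. \<i> * f w) - N f) ` A"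
      using N_scale[OF f, of "-\<i>"] by (intro image_eqI[OF _ A_scale[OF f, of "-\<i>"]]) simp
  qed
  then show ?thesis by (simp add: q_def)
qed

lemma r_compose_ii: "r (\<lambda>f. \<phi> (\<lambda>w. \<i> * f w)) (\<lambda>f. \<psi> (\<lambda>w. \<i> * f w)) = r \<phi> \<psi>"
  unfolding r_def using q_compose_ii[of "\<lambda>f. \<phi> f + \<psi> f"] q_compose_ii[of "\<lambda>f. \<phi> f - \<psi> f"] by simp

lemma L_compose_ii:
  assumes "\<phi> \<in> L"
  shows "(\<lambda>f. \<phi> (\<lambda>w. \<i> * f w)) \<in> L"
proof (rule LI[OF _ _ q_nonneg[OF assms]])
  fix f assume f: "f \<in> A"
  show "(\<phi> (\<lambda>w. \<i> * f w))\<^sup>2 \<le> q \<phi> * N f"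
    using square_le_q[OF assms A_scale[OF f, of \<i>]] by (simp add: N_scale[OF f])
  show "\<phi> (\<lambda>w. \<i> * (f w + g w)) = \<phi> (\<lambda>w. \<i> * f w) + \<phi> (\<lambda>w. \<i> * g w)" if g: "g \<in> A" for g
    using L_lin(1)[OF assms A_scale[OF f, of \<i>] A_scale[OF g, of \<i>]] by (simp add: algebra_simps)
  show "\<phi> (\<lambda>w. \<i> * (of_real c * f w)) = c * \<phi> (\<lambda>w. \<i> * f w)" for c
    using L_lin(2)[OF assms A_scale[OF f, of \<i>], of c] by (simp add: mult.left_commute)
qed

text \<open>Functionals are total, but the identities between slice derivatives hold only for
  \<open>f\<close> in \<open>A\<close>; \<open>q\<close> looks no further.\<close>

lemma q_cong: "(\<And>f. f \<in> A \<Longrightarrow> \<phi> f = \<psi> f) \<Longrightarrow> q \<phi> = q \<psi>"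
  unfolding q_def by (rule SUP_cong) simp_all

lemma r_cong:
  assumes "\<And>f. f \<in> A \<Longrightarrow> \<phi> f = \<phi>' f" "\<And>f. f \<in> A \<Longrightarrow> \<psi> f = \<psi>' f"
  shows "r \<phi> \<psi> = r \<phi>' \<psi>'"
  unfolding r_def
  using q_cong[of "\<lambda>f. \<phi> f + \<psi> f" "\<lambda>f. \<phi>' f + \<psi>' f"] q_cong[of "\<lambda>f. \<phi> f - \<psi> f" "\<lambda>f. \<phi>' f - \<psi>' f"] assms
  by simp

text \<open>Let \<open>a0\<close> be evaluation at \<open>z\<close> and \<open>a1\<close> the
  derivative along \<open>u\<close>, as functionals. The Levi form is the squared distance of
  \<open>a1\<close> from the complex line through \<open>a0\<close>, divided by \<open>q a0\<close>;
  the second derivatives along \<open>u\<close> and i u have opposite signs and cancel. Strictness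
  needs a function vanishing at \<open>z\<close> but not to first order along
  \<open>u\<close>.\<close>

theorem bergman_metric_pos:
  assumes z: "z \<in> D" and u: "u \<noteq> 0"
  shows "0 < bergman_metric D z u"
proof -
  obtain e where e: "0 < e" "ball z e \<subseteq> D" using open_D z openE by blast
  \<comment> \<open>Half of \<open>e\<close> is for the displacement along the slice, half for the
    ball around the displaced point; \<open>d\<close> is chosen so that
    \<open>2 * d * (norm u + 1) = \<rho>\<close>. Only the norm of the direction enters, so both u
    and i u are covered.\<close>
  define \<rho> where "\<rho> = e / 2"
  define d where "d = \<rho> / (2 * (norm u + 1))"
  have nu: "0 < norm u + 1" by (simp add: add_nonneg_pos)
  have pos: "0 < \<rho>" "0 < d" using e nu by (simp_all add: \<rho>_def d_def)
  have "slice_disc D z v \<rho> d" if v: "norm v = norm u" for v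
  proof unfold_locales
    fix \<zeta> assume "cmod \<zeta> < 2 * d"
    then have "cmod \<zeta> * (norm u + 1) < \<rho>" using nu by (simp add: d_def field_simps)
    then have "norm (cscale \<zeta> v) < \<rho>"
      using v by (simp add: norm_cscale algebra_simps) (smt (verit) norm_ge_zero)
    then have "ball (z + cscale \<zeta> v) \<rho> \<subseteq> ball z e"
      by (simp add: ball_subset_ball_iff \<rho>_def dist_norm)
    then show "ball (z + cscale \<zeta> v) \<rho> \<subseteq> D" using e by blast
  qed (use pos in auto)
  then interpret X: slice_disc D z u \<rho> d + Y: slice_disc D z "cscale \<i> u" \<rho> d
    by (simp_all add: norm_cscale)
  define a0 where "a0 = X.E 0 0"
  define a1 where "a1 = X.E 1 0"
  define a2 where "a2 = X.E 2 0"
  \<comment> \<open>\<open>b0\<close> and \<open>b1\<close> are i times \<open>a0\<close> and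
    \<open>a1\<close> in the dual; \<open>a0\<close> and \<open>b0\<close> span, over the reals, the
    complex line of the evaluation.\<close>
  define b0 where "b0 = (\<lambda>f. a0 (\<lambda>w. \<i> * f w))"
  define b1 where "b1 = (\<lambda>f. a1 (\<lambda>w. \<i> * f w))"
  have a0: "a0 f = Re (f z)" for f using pos by (simp add: a0_def X.E_def X.F_def)
  have a1: "a1 f = Re (deriv (X.F f) 0)" for f using pos by (simp add: a1_def X.E_def)
  have LL: "a0 \<in> L" "a1 \<in> L" "a2 \<in> L" "b0 \<in> L" "b1 \<in> L"
    unfolding a0_def a1_def a2_def b0_def b1_def by (intro L_compose_ii X.E_in_L)+
  have YF: "Y.F f = (\<lambda>\<zeta>. X.F f (\<i> * \<zeta>))" for f
    by (simp add: X.F_def Y.F_def fun_eq_iff mult.commute)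
  have YE: "Y.E k 0 f = Re (\<i> ^ k * (deriv ^^ k) (X.F f) 0)" if f: "f \<in> A" for k f
    using higher_deriv_compose_linear[where u = \<i> and n = k and z = 0 and S = "ball 0 (2 * d)",
        OF X.F_holomorphic[OF f] open_ball open_ball] pos
    by (simp add: Y.E_def YF norm_mult)
  have Y0: "Y.E 0 0 f = a0 f" if "f \<in> A" for f
    using YE[OF that, of 0] by (simp add: a0 X.F_def)
  have Y1: "Y.E 1 0 f = b1 f" if f: "f \<in> A" for f
  proof -
    have "deriv (X.F (\<lambda>w. \<i> * f w)) 0 = \<i> * deriv (X.F f) 0"
      using higher_deriv_cmult[OF X.F_holomorphic[OF f] _ open_ball, of 0 1 \<i>] pos
      by (simp add: X.F_def[abs_def])
    then show ?thesis using YE[OF f, of 1] by (simp add: b1_def a1)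
  qed
  have Y2: "Y.E 2 0 f = - a2 f" if "f \<in> A" for f
    using YE[OF that, of 2] pos by (simp add: a2_def X.E_def)
  have b1b0: "(\<lambda>f. b0 (\<lambda>w. \<i> * f w)) = (\<lambda>f. - a0 f)"
    by (simp add: b0_def a0 fun_eq_iff)
  \<comment> \<open>Composing twice with the isometry gives minus the identity, so
    \<open>r a0 b0 = - r b0 a0\<close>, and symmetry makes it vanish.\<close>
  have ab0: "r a0 b0 = 0"
    using r_compose_ii[of a0 b0] LL by (simp add: b1b0 r_minus_right r_commute[of b0 a0] flip: b0_def)
  have a1b0: "r a1 b0 = - r b1 a0"
    using r_compose_ii[of a1 b0] LL by (simp add: b1b0 r_minus_right flip: b1_def)
  have qb: "q b0 = q a0" "q b1 = q a1" unfolding b0_def b1_def by (rule q_compose_ii)+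
  have k: "0 < q a0" by (rule q_pos[OF LL(1) const_in_A[of 1]]) (simp add: a0)
  define \<alpha> where "\<alpha> = r a1 a0"
  define \<beta> where "\<beta> = r b1 a0"
  \<comment> \<open>\<open>a1\<close> minus its orthogonal projection onto the span of
    \<open>a0\<close> and \<open>b0\<close>; the minus sign at \<beta> comes from
    \<open>a1b0\<close>, and \<open>q b0 = q a0\<close>.\<close>
  define P where "P = (\<lambda>f. a1 f - (\<alpha> / q a0 * a0 f + (- \<beta> / q a0) * b0 f))"
  have PL: "P \<in> L" unfolding P_def by (intro L_closed LL)
  obtain j where j: "u $ j \<noteq> 0" using u by (auto simp: vec_eq_iff)
  \<comment> \<open>It vanishes at \<open>z\<close>, so \<open>a0\<close> and \<open>b0\<close>
    annihilate it. The conjugate factor makes its derivative along \<open>u\<close> equal to the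
    squared modulus of \<open>u $ j\<close>, a positive real that survives the real part.\<close>
  define g where "g = (\<lambda>w. cnj (u $ j) * (w $ j + (- (z $ j))))"
  obtain B where B: "\<And>w. w \<in> D \<Longrightarrow> norm w \<le> B" using bounded_D by (auto simp: bounded_iff)
  have gA: "g \<in> A"
  proof (rule bounded_holo_in_A)
    show "holo g D" unfolding g_def by (intro holo_mult holo_add holo_const holo_nth)
    show "cmod (g w) \<le> cmod (u $ j) * (B + cmod (z $ j))" if "w \<in> D" for w
      using norm_triangle_ineq4[of "w $ j" "z $ j"] B[OF that] Finite_Cartesian_Product.norm_nth_le[of w j]
      unfolding g_def by (simp add: norm_mult mult_left_mono)
  qed
  have "X.F g = (\<lambda>\<zeta>. (cnj (u $ j) * u $ j) * \<zeta>)"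
    by (simp add: X.F_def g_def cscale_def fun_eq_iff)
  then have "a1 g = (Re (u $ j))\<^sup>2 + (Im (u $ j))\<^sup>2"
    by (simp add: a1 power2_eq_square)
  then have "a1 g \<noteq> 0" using j by (simp add: sum_power2_eq_zero_iff complex_eq_iff)
  then have Pg: "P g \<noteq> 0" by (simp add: P_def a0 b0_def g_def)
  from q_pos[OF PL gA Pg] have "0 < q P" .
  also have "q P = q a1 - (\<alpha>\<^sup>2 + \<beta>\<^sup>2) / q a0"
  proof -
    have "q P = r P P" using PL by (simp add: r_self)
    also have "\<dots> = q a1 - 2 * (\<alpha> / q a0) * \<alpha> + 2 * (- \<beta> / q a0) * \<beta>
        + ((\<alpha> / q a0)\<^sup>2 + (\<beta> / q a0)\<^sup>2) * q a0"
      unfolding P_def using LL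
      by (simp only: r_diff_left r_diff_right r_add_left r_add_right r_scale_left r_scale_right L_closed
          r_self r_commute[of a0 a1] r_commute[of b0 a1] r_commute[of b0 a0] ab0 a1b0 qb
          flip: \<alpha>_def \<beta>_def)
        (simp add: algebra_simps power2_eq_square)
    also have "\<dots> = q a1 - (\<alpha>\<^sup>2 + \<beta>\<^sup>2) / q a0"
      using k by (simp add: field_simps power2_eq_square)
    finally show ?thesis .
  qed
  finally have strict: "(\<alpha>\<^sup>2 + \<beta>\<^sup>2) / q a0 < q a1" by simp
  have dx: "deriv (\<lambda>x. deriv (\<lambda>x'. ln (bergman_kernel_diag D (z + cscale (Complex x' 0) u))) x) 0
      = (2 * q a1 + 2 * r a0 a2) / q a0 - (2 * \<alpha> / q a0)\<^sup>2"
    using X.deriv_deriv_ln_kernel_slice r_commute[OF LL(1,2)]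
    unfolding a0_def[symmetric] a1_def[symmetric] a2_def[symmetric]
    by (simp add: complex_of_real_def \<alpha>_def)
  have "of_real y * \<i> = Complex 0 y" for y by (simp add: complex_eq_iff)
  moreover have "r (Y.E 0 0) (Y.E 2 0) = - r a0 a2"
    using r_cong[of "Y.E 0 0" a0 "Y.E 2 0" "\<lambda>f. - a2 f"] Y0 Y2 LL by (simp add: r_minus_right)
  moreover have "r (Y.E 0 0) (Y.E 1 0) = \<beta>"
    using r_cong[of "Y.E 0 0" a0 "Y.E 1 0" b1] Y0 Y1 r_commute[OF LL(1,5)] by (simp add: \<beta>_def)
  moreover have "q (Y.E 0 0) = q a0" "q (Y.E 1 0) = q a1"
    using q_cong[of "Y.E 0 0" a0] q_cong[of "Y.E 1 0" b1] Y0 Y1 qb by simp_all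
  ultimately have dy: "deriv (\<lambda>y. deriv (\<lambda>y'. ln (bergman_kernel_diag D (z + cscale (Complex 0 y') u))) y) 0
      = (2 * q a1 - 2 * r a0 a2) / q a0 - (2 * \<beta> / q a0)\<^sup>2"
    using Y.deriv_deriv_ln_kernel_slice by simp
  have "bergman_metric D z u = (q a1 - (\<alpha>\<^sup>2 + \<beta>\<^sup>2) / q a0) / q a0"
    unfolding bergman_metric_def Let_def dx dy using k by (simp add: field_simps power2_eq_square)
  then show ?thesis using strict k by simp
qed

end

subsection \<open>Multiplication operators\<close>

locale bloch_domain = bounded_open D for D :: "(complex^'n) set" +
  assumes connected_D: "connected D" and zero_in_D: "0 \<in> D"
begin

lemma sqrt_metric_pos: "z \<in> D \<Longrightarrow> u \<noteq> 0 \<Longrightarrow> 0 < sqrt (bergman_metric D z u)"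
  using bergman_metric_pos by simp

lemma Qf_upper: "u \<noteq> 0 \<Longrightarrow> ereal (cmod (grad_dir f z u) / sqrt (bergman_metric D z u)) \<le> Qf D f z"
  unfolding Qf_def by (rule SUP_upper) simp

text \<open>Over an empty index set the supremum in \<open>Qf\<close> would be minus infinity; index
  types are inhabited, so a nonzero vector exists.\<close>

lemma nonzero_nonempty: "{u :: complex^'n. u \<noteq> 0} \<noteq> {}"
  by (auto intro!: exI[of _ "axis undefined 1"] simp: axis_eq_0_iff)

lemma Qf_nonneg:
  assumes "z \<in> D"
  shows "0 \<le> Qf D f z"
proof -
  obtain u :: "complex^'n" where u: "u \<noteq> 0" using nonzero_nonempty by blast
  then have "0 \<le> ereal (cmod (grad_dir f z u) / sqrt (bergman_metric D z u))"
    using sqrt_metric_pos[OF assms u] by simp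
  then show ?thesis using Qf_upper[OF u] order_trans by blast
qed

lemma Qf_le_beta: "z \<in> D \<Longrightarrow> Qf D f z \<le> beta D f"
  unfolding beta_def by (rule SUP_upper)

lemma beta_nonneg: "0 \<le> beta D f"
  using Qf_nonneg[OF zero_in_D] Qf_le_beta[OF zero_in_D] order_trans by blast

lemma beta_least:
  assumes "\<And>z u. z \<in> D \<Longrightarrow> u \<noteq> 0 \<Longrightarrow> cmod (grad_dir f z u) / sqrt (bergman_metric D z u) \<le> b"
  shows "beta D f \<le> ereal b"
  unfolding beta_def Qf_def using assms by (intro SUP_least) auto

lemma grad_le_beta:
  assumes "z \<in> D" "u \<noteq> 0" "beta D f = ereal b"
  shows "cmod (grad_dir f z u) / sqrt (bergman_metric D z u) \<le> b"
  using order_trans[OF Qf_upper[OF assms(2)] Qf_le_beta[OF assms(1), of f]] assms(3) by simp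

lemma grad_dir_mult:
  assumes "holo f D" "holo g D" "z \<in> D"
  shows "grad_dir (\<lambda>z. f z * g z) z u = f z * grad_dir g z u + grad_dir f z u * g z"
  unfolding grad_dir_def frechet_derivative_at[OF has_derivative_mult_holo[OF assms], symmetric] ..

text \<open>This shape covers both rescaling, with a = 0, and the recentring with a = f(0).\<close>

lemma grad_dir_affine:
  assumes "holo f D" "z \<in> D"
  shows "grad_dir (\<lambda>z. c * (f z - a)) z u = c * grad_dir f z u"
proof -
  have "((\<lambda>z. c * (f z - a)) has_derivative (\<lambda>h. c * frechet_derivative f (at z) h)) (at z)"
    using holo_has_derivative[OF assms] by (auto intro!: derivative_eq_intros)
  from frechet_derivative_at[OF this] show ?thesis
    unfolding grad_dir_def by (rule fun_cong[OF sym])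
qed

lemma grad_dir_const: "grad_dir (\<lambda>z. c) z u = 0"
  unfolding grad_dir_def by simp

lemma holo_affine: "holo f D \<Longrightarrow> holo (\<lambda>z. c * (f z - a)) D"
  by (intro holo_mult holo_diff holo_const)

lemma Qf_affine:
  assumes "holo f D" "z \<in> D"
  shows "Qf D (\<lambda>z. c * (f z - a)) z = ereal (cmod c) * Qf D f z"
proof -
  have "Qf D (\<lambda>z. c * (f z - a)) z
      = (SUP u\<in>{u. u \<noteq> 0}. ereal (cmod c) * ereal (cmod (grad_dir f z u) / sqrt (bergman_metric D z u)))"
    unfolding Qf_def by (simp add: grad_dir_affine[OF assms] norm_mult)
  also have "\<dots> = ereal (cmod c) * Qf D f z"
    unfolding Qf_def using nonzero_nonempty sqrt_metric_pos[OF assms(2)]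
    by (intro SUP_ereal_mult_left) (auto intro: divide_nonneg_pos)
  finally show ?thesis .
qed

lemma beta_affine:
  assumes "holo f D"
  shows "beta D (\<lambda>z. c * (f z - a)) = ereal (cmod c) * beta D f"
proof -
  have "beta D (\<lambda>z. c * (f z - a)) = (SUP z\<in>D. ereal (cmod c) * Qf D f z)"
    unfolding beta_def by (simp add: Qf_affine[OF assms])
  also have "\<dots> = ereal (cmod c) * beta D f"
    unfolding beta_def using zero_in_D Qf_nonneg by (intro SUP_ereal_mult_left) auto
  finally show ?thesis .
qed

lemma bloch_norm_scale:
  assumes "holo f D"
  shows "bloch_norm D (\<lambda>z. c * f z) = ereal (cmod c) * bloch_norm D f"
  using beta_affine[OF assms, of c 0] beta_nonneg[of f]
  by (cases "beta D f") (auto simp: bloch_norm_def norm_mult distrib_left)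

lemma Qf_const: "Qf D (\<lambda>z. c) z = 0"
  unfolding Qf_def using nonzero_nonempty by (simp add: grad_dir_const)

lemma beta_const: "beta D (\<lambda>z. c) = 0"
  unfolding beta_def Qf_const using zero_in_D by (intro cSUP_const) auto

lemma bloch_holo: "f \<in> bloch D \<Longrightarrow> holo f D"
  by (simp add: bloch_def)

lemma bloch_beta:
  assumes "f \<in> bloch D"
  obtains b where "beta D f = ereal b" "0 \<le> b"
  using assms beta_nonneg[of f] by (cases "beta D f") (auto simp: bloch_def)

lemma const_in_bloch: "(\<lambda>z. c) \<in> bloch D"
  by (simp add: bloch_def holo_const beta_const)

lemma affine_in_bloch:
  assumes "f \<in> bloch D"
  shows "(\<lambda>z. c * (f z - a)) \<in> bloch D"
proof -
  obtain b where "beta D f = ereal b" using bloch_beta[OF assms] .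
  then have "beta D (\<lambda>z. c * (f z - a)) = ereal (cmod c * b)"
    using beta_affine[OF bloch_holo[OF assms], of c a] by simp
  then show ?thesis by (simp add: bloch_def holo_affine bloch_holo[OF assms])
qed

lemma const_in_little_bloch: "(\<lambda>z. c) \<in> little_bloch_star D"
proof -
  have "Qf D (\<lambda>z. c) = (\<lambda>z. 0)" by (simp add: Qf_const fun_eq_iff)
  then show ?thesis by (simp add: little_bloch_star_def const_in_bloch)
qed

lemma affine_in_little_bloch:
  assumes f: "f \<in> little_bloch_star D"
  shows "(\<lambda>z. c * (f z - a)) \<in> little_bloch_star D"
  unfolding little_bloch_star_def
proof (intro CollectI conjI ballI)
  have fb: "f \<in> bloch D" using f by (simp add: little_bloch_star_def)
  then show "(\<lambda>z. c * (f z - a)) \<in> bloch D" by (rule affine_in_bloch)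
  fix w assume "w \<in> dist_boundary D"
  then have "(Qf D f \<longlongrightarrow> 0) (at w within D)" using f by (simp add: little_bloch_star_def)
  then have "((\<lambda>z. ereal (cmod c) * Qf D f z) \<longlongrightarrow> ereal (cmod c) * 0) (at w within D)"
    by (rule tendsto_cmult_ereal[rotated]) simp
  then have "((\<lambda>z. ereal (cmod c) * Qf D f z) \<longlongrightarrow> 0) (at w within D)" by simp
  moreover have "\<forall>\<^sub>F z in at w within D. ereal (cmod c) * Qf D f z = Qf D (\<lambda>z. c * (f z - a)) z"
    by (auto simp: eventually_at_filter Qf_affine[OF bloch_holo[OF fb]])
  ultimately show "(Qf D (\<lambda>z. c * (f z - a)) \<longlongrightarrow> 0) (at w within D)"
    by (rule Lim_transform_eventually)
qed

section \<open>Gradients of powers and the region of large modulus\<close>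

lemma grad_dir_power:
  assumes "holo \<psi> D" "z \<in> D"
  shows "grad_dir (\<lambda>z. \<psi> z ^ Suc k) z u = of_nat (Suc k) * \<psi> z ^ k * grad_dir \<psi> z u"
proof -
  have "((\<lambda>z. \<psi> z ^ Suc k) has_derivative
      (\<lambda>h. of_nat (Suc k) * frechet_derivative \<psi> (at z) h * \<psi> z ^ (Suc k - 1))) (at z)"
    by (intro has_derivative_power holo_has_derivative[OF assms])
  from frechet_derivative_at[OF this]
  have "frechet_derivative (\<lambda>z. \<psi> z ^ Suc k) (at z)
      = (\<lambda>h. of_nat (Suc k) * frechet_derivative \<psi> (at z) h * \<psi> z ^ (Suc k - 1))" ..
  then show ?thesis unfolding grad_dir_def by simp
qed

text \<open>The level set of \<open>\<psi>\<close> at a value of modulus above \<open>m\<close> is open and closed in \<open>D\<close>.\<close>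

lemma bounded_if_grad_zero_where_large:
  assumes \<psi>: "holo \<psi> D" and m0: "cmod (\<psi> 0) \<le> m"
    and grad: "\<And>z u. z \<in> D \<Longrightarrow> m < cmod (\<psi> z) \<Longrightarrow> u \<noteq> 0 \<Longrightarrow> grad_dir \<psi> z u = 0"
    and z: "z \<in> D"
  shows "cmod (\<psi> z) \<le> m"
proof (rule ccontr)
  assume "\<not> cmod (\<psi> z) \<le> m"
  then have large: "m < cmod (\<psi> z)" by simp
  have cont: "continuous_on D \<psi>" using \<psi> by (rule holo_continuous_on)
  define U where "U = {w \<in> D. \<psi> w = \<psi> z}"
  define V where "V = {w \<in> D. \<psi> w \<noteq> \<psi> z}"
  have "V = D \<inter> \<psi> -` (- {\<psi> z})" by (auto simp: V_def)
  then have "open V" using continuous_open_preimage[OF cont open_D, of "- {\<psi> z}"] by (simp add: open_Compl)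
  moreover have "open U"
  proof (rule openI)
    fix w assume w: "w \<in> U"
    let ?W = "D \<inter> \<psi> -` {y. m < cmod y}"
    have "open {y :: complex. m < cmod y}"
      by (intro open_Collect_less continuous_intros)
    then have "open ?W" by (rule continuous_open_preimage[OF cont open_D])
    moreover have "w \<in> ?W" using w large by (simp add: U_def)
    ultimately obtain e where e: "0 < e" "ball w e \<subseteq> ?W" using openE by blast
    have "(\<psi> has_derivative (\<lambda>h. 0)) (at x)" if "x \<in> ball w e" for x
    proof -
      have x: "x \<in> D" "m < cmod (\<psi> x)" using e(2) that by auto
      have "frechet_derivative \<psi> (at x) h = 0" for h
        using grad[OF x, of h] linear_0[OF has_derivative_linear[OF holo_has_derivative[OF \<psi> x(1)]]]
        by (cases "h = 0") (auto simp: grad_dir_def)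
      then have "frechet_derivative \<psi> (at x) = (\<lambda>h. 0)" by (simp add: fun_eq_iff)
      then show ?thesis using holo_has_derivative[OF \<psi> x(1)] by (simp only:)
    qed
    then have "\<psi> x = \<psi> w" if "x \<in> ball w e" for x
      using has_derivative_zero_unique_connected[OF open_ball connected_ball, of w e \<psi> x w] that e(1) by auto
    then have "ball w e \<subseteq> U" using e(2) w by (auto simp: U_def)
    then show "\<exists>e>0. ball w e \<subseteq> U" using e(1) by blast
  qed
  moreover have "D = U \<union> V" "U \<inter> V = {}" by (auto simp: U_def V_def)
  ultimately have "U \<inter> D = {} \<or> V \<inter> D = {}"
    using connectedD[OF connected_D, of U V] by auto
  then have "\<psi> 0 = \<psi> z" using z zero_in_D by (auto simp: U_def V_def)
  then show False using large m0 by simp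
qed

text \<open>\<open>X\<close> stands for either of the two Bloch spaces.\<close>

context
  fixes X :: "(complex^'n \<Rightarrow> complex) set" and \<psi> :: "complex^'n \<Rightarrow> complex"
  assumes X_bloch: "X \<subseteq> bloch D"
    and X_const: "\<And>c. (\<lambda>z. c) \<in> X"
    and X_affine: "\<And>f c a. f \<in> X \<Longrightarrow> (\<lambda>z. c * (f z - a)) \<in> X"
    and \<psi>: "holo \<psi> D"
    and bounded: "mult_bounded D X \<psi>"
begin

lemma mult_in_X: "f \<in> X \<Longrightarrow> (\<lambda>z. \<psi> z * f z) \<in> X"
  using bounded by (simp add: mult_bounded_def)

lemma symbol_in_X: "\<psi> \<in> X"
  using mult_in_X[OF X_const[of 1]] by simp

lemma X_scale: "f \<in> X \<Longrightarrow> (\<lambda>z. c * f z) \<in> X"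
  using X_affine[of f c 0] by simp

lemma opnorm_upper: "f \<in> X \<Longrightarrow> bloch_norm D f \<le> 1 \<Longrightarrow> bloch_norm D (\<lambda>z. \<psi> z * f z) \<le> mult_opnorm D X \<psi>"
  unfolding mult_opnorm_def by (rule SUP_upper) simp

lemma bloch_norm_le_opnorm: "bloch_norm D \<psi> \<le> mult_opnorm D X \<psi>"
  using opnorm_upper[OF X_const[of 1]] by (simp add: bloch_norm_def beta_const)

lemma bloch_norm_real:
  assumes "f \<in> X"
  obtains n where "bloch_norm D f = ereal n" "0 \<le> n"
proof -
  obtain b where "beta D f = ereal b" "0 \<le> b" using bloch_beta X_bloch assms by blast
  then show thesis using that[of "cmod (f 0) + b"] by (simp add: bloch_norm_def)
qed

lemma opnorm_real:
  obtains m where "mult_opnorm D X \<psi> = ereal m" "0 \<le> m"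
proof -
  obtain n where "bloch_norm D \<psi> = ereal n" "0 \<le> n" using bloch_norm_real[OF symbol_in_X] .
  then show ?thesis
    using that bloch_norm_le_opnorm bounded by (cases "mult_opnorm D X \<psi>") (auto simp: mult_bounded_def)
qed

text \<open>\<open>mult_opnorm\<close> tests only the unit ball. Dividing \<open>f\<close> by
  \<open>n + \<epsilon>\<close> instead of \<open>n\<close> also covers
  \<open>n = 0\<close>.\<close>

lemma opnorm_bound:
  assumes m: "mult_opnorm D X \<psi> = ereal m" "0 \<le> m"
    and f: "f \<in> X" and n: "bloch_norm D f \<le> ereal n" "0 \<le> n"
  shows "bloch_norm D (\<lambda>z. \<psi> z * f z) \<le> ereal (m * n)"
proof -
  obtain p where p: "bloch_norm D (\<lambda>z. \<psi> z * f z) = ereal p" "0 \<le> p"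
    using bloch_norm_real[OF mult_in_X[OF f]] .
  obtain n' where n': "bloch_norm D f = ereal n'" "0 \<le> n'" using bloch_norm_real[OF f] .
  have hf: "holo f D" and h\<psi>f: "holo (\<lambda>z. \<psi> z * f z) D" using f X_bloch mult_in_X[OF f] bloch_holo by auto
  have "p \<le> m * n + e" if e: "0 < e" for e
  proof -
    \<comment> \<open>The denominator \<open>m + 1\<close> keeps this meaningful for
      \<open>m = 0\<close> and gives \<open>m * \<epsilon> \<le> e\<close>.\<close>
    define \<epsilon> where "\<epsilon> = e / (m + 1)"
    have \<epsilon>: "0 < \<epsilon>" "m * \<epsilon> \<le> e" using e m by (simp_all add: \<epsilon>_def field_simps)
    let ?c = "of_real (1 / (n + \<epsilon>)) :: complex"
    have nc: "cmod ?c = 1 / (n + \<epsilon>)" using \<epsilon> n by (simp add: norm_divide flip: of_real_add)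
    have "bloch_norm D (\<lambda>z. ?c * f z) \<le> 1"
      unfolding bloch_norm_scale[OF hf] nc n' using n n' \<epsilon> by simp
    from opnorm_upper[OF X_scale[OF f] this]
    have "bloch_norm D (\<lambda>z. ?c * (\<psi> z * f z)) \<le> ereal m"
      unfolding m by (simp only: mult.left_commute)
    then have "p \<le> m * (n + \<epsilon>)"
      unfolding bloch_norm_scale[OF h\<psi>f] nc p using n \<epsilon> by (simp add: field_simps)
    then show ?thesis using \<epsilon> by (simp add: algebra_simps)
  qed
  then show ?thesis unfolding p by (simp add: field_le_epsilon)
qed

lemma power_in_X:
  assumes m: "mult_opnorm D X \<psi> = ereal m" "0 \<le> m"
  shows "(\<lambda>z. \<psi> z ^ k) \<in> X \<and> bloch_norm D (\<lambda>z. \<psi> z ^ k) \<le> ereal (m ^ k)"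
proof (induction k)
  case 0
  then show ?case using X_const[of 1] by (simp add: bloch_norm_def beta_const one_ereal_def)
next
  case (Suc k)
  then show ?case
    using mult_in_X[of "\<lambda>z. \<psi> z ^ k"] opnorm_bound[OF m, of "\<lambda>z. \<psi> z ^ k" "m ^ k"] m by simp
qed

text \<open>Since \<open>\<nabla>(\<psi>\<^sup>k) = k \<psi>\<^sup>k\<^sup>-\<^sup>1 \<nabla>\<psi>\<close> and \<open>\<beta>(\<psi>\<^sup>k) \<le> m\<^sup>k\<close>, the factor \<open>k\<close> forces \<open>\<nabla>\<psi> = 0\<close> wherever
  \<open>\<bar>\<psi>\<bar> > m\<close>.\<close>

lemma grad_zero_where_large:
  assumes m: "mult_opnorm D X \<psi> = ereal m" "0 \<le> m"
    and z: "z \<in> D" and large: "m < cmod (\<psi> z)" and u: "u \<noteq> 0"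
  shows "grad_dir \<psi> z u = 0"
proof (rule ccontr)
  assume nz: "grad_dir \<psi> z u \<noteq> 0"
  define c where "c = cmod (grad_dir \<psi> z u) / sqrt (bergman_metric D z u)"
  have c: "0 < c" using nz sqrt_metric_pos[OF z u] by (simp add: c_def)
  have "real (Suc k) * c \<le> m" for k
  proof -
    have P: "(\<lambda>z. \<psi> z ^ Suc k) \<in> X" "bloch_norm D (\<lambda>z. \<psi> z ^ Suc k) \<le> ereal (m ^ Suc k)"
      using power_in_X[OF m, of "Suc k"] by auto
    obtain b where b: "beta D (\<lambda>z. \<psi> z ^ Suc k) = ereal b"
      using bloch_beta[of "\<lambda>z. \<psi> z ^ Suc k"] P X_bloch by blast
    have "cmod (\<psi> 0 ^ Suc k) + b \<le> m ^ Suc k" using P(2) unfolding bloch_norm_def b by simp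
    moreover have "real (Suc k) * cmod (\<psi> z) ^ k * c \<le> b"
      using grad_le_beta[OF z u b] unfolding grad_dir_power[OF \<psi> z]
      by (simp add: c_def norm_mult norm_power mult.assoc flip: of_nat_Suc)
    \<comment> \<open>One factor \<open>m\<close> is kept and the others are enlarged, so that the
      power of \<open>cmod (\<psi> z)\<close> cancels and \<open>real (Suc k) * c\<close> stays
      bounded.\<close>
    moreover have "m ^ Suc k \<le> m * cmod (\<psi> z) ^ k"
      using large m by (simp add: mult_left_mono power_mono)
    ultimately have "real (Suc k) * cmod (\<psi> z) ^ k * c \<le> m * cmod (\<psi> z) ^ k"
      using norm_ge_zero[of "\<psi> 0 ^ Suc k"] by linarith
    then have "(real (Suc k) * c) * cmod (\<psi> z) ^ k \<le> m * cmod (\<psi> z) ^ k" by (simp only: mult_ac)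
    moreover have "0 < cmod (\<psi> z) ^ k" using large m by (intro zero_less_power) linarith
    ultimately show ?thesis by (rule mult_right_le_imp_le)
  qed
  moreover obtain k where "m < real k * c" using reals_Archimedean3[OF c] by blast
  ultimately show False using c by (metis lessI less_imp_le mult_right_mono not_le of_nat_mono order_less_le_trans)
qed

lemma sup_norm_le_opnorm: "sup_norm D \<psi> \<le> mult_opnorm D X \<psi>"
proof -
  obtain m where m: "mult_opnorm D X \<psi> = ereal m" "0 \<le> m" using opnorm_real .
  obtain b where b: "beta D \<psi> = ereal b" "0 \<le> b" using bloch_beta symbol_in_X X_bloch by blast
  have "cmod (\<psi> 0) \<le> m" using bloch_norm_le_opnorm b by (simp add: m bloch_norm_def)
  then have "cmod (\<psi> z) \<le> m" if "z \<in> D" for z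
    using bounded_if_grad_zero_where_large[OF \<psi> _ grad_zero_where_large[OF m] that] by blast
  then show ?thesis unfolding sup_norm_def m by (intro SUP_least) simp
qed

section \<open>The upper bound through omega and sigma\<close>

lemma omega_nonneg: "0 \<le> omega_X D X z"
  unfolding omega_X_def using X_const[of 0]
  by (intro SUP_upper2[of "\<lambda>z. 0"]) (auto simp: bloch_norm_def beta_const)

lemma sigma_nonneg: "0 \<le> sigma_X D X \<psi>"
  unfolding sigma_X_def using zero_in_D omega_nonneg Qf_nonneg
  by (intro SUP_upper2[of 0]) auto

text \<open>Write \<open>f = f(0) + g\<close>; here \<open>\<omega>\<close> only controls \<open>g\<close> up to \<open>\<beta>\<^sub>f + \<epsilon>\<close>, which also covers \<open>\<beta>\<^sub>f = 0\<close>.\<close>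

lemma centered_mult_grad_le:
  assumes f: "f \<in> X" and bf: "beta D f = ereal bf" "0 \<le> bf"
    and t: "sigma_X D X \<psi> = ereal t" "0 \<le> t" and z: "z \<in> D" and u: "u \<noteq> 0"
  shows "cmod (f z - f 0) * (cmod (grad_dir \<psi> z u) / sqrt (bergman_metric D z u)) \<le> bf * t"
    (is "_ * ?b \<le> _")
proof (rule field_le_epsilon)
  fix e :: real assume e: "0 < e"
  have hf: "holo f D" using f X_bloch bloch_holo by blast
  define \<epsilon> where "\<epsilon> = e / (t + 1)"
  have \<epsilon>: "0 < \<epsilon>" "\<epsilon> * t \<le> e" using e t by (simp_all add: \<epsilon>_def field_simps)
  let ?c = "of_real (1 / (bf + \<epsilon>)) :: complex"
  let ?g = "\<lambda>z. ?c * (f z - f 0)"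
  have nc: "cmod ?c = 1 / (bf + \<epsilon>)" using \<epsilon> bf by (simp add: norm_divide flip: of_real_add)
  have "beta D ?g = ereal (1 / (bf + \<epsilon>) * bf)"
    unfolding beta_affine[OF hf] nc bf by simp
  moreover have "1 / (bf + \<epsilon>) * bf \<le> 1" using \<epsilon> bf by simp
  ultimately have "bloch_norm D ?g \<le> 1" by (simp add: bloch_norm_def)
  then have "?g \<in> {f \<in> X. f 0 = 0 \<and> bloch_norm D f \<le> 1}"
    by (intro CollectI conjI X_affine[OF f]) simp_all
  then have "ereal (cmod (?g z)) \<le> omega_X D X z"
    unfolding omega_X_def by (rule SUP_upper)
  moreover have b0: "0 \<le> ?b" using sqrt_metric_pos[OF z u] by simp
  \<comment> \<open>The product is taken in the extended reals because \<open>omega_X\<close> may be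
    infinite at \<open>z\<close>; only the supremum \<open>t\<close> is known to be finite.\<close>
  ultimately have "ereal (cmod (?g z)) * ereal ?b \<le> omega_X D X z * Qf D \<psi> z"
    by (intro ereal_mult_mono omega_nonneg Qf_upper[OF u]) simp_all
  also have "\<dots> \<le> ereal t" unfolding t(1)[symmetric] sigma_X_def using z by (rule SUP_upper)
  finally have "1 / (bf + \<epsilon>) * cmod (f z - f 0) * ?b \<le> t"
    unfolding norm_mult nc by simp
  moreover have "x * y \<le> (bf + \<epsilon>) * t" if "1 / (bf + \<epsilon>) * x * y \<le> t" for x y
    using that \<epsilon> bf by (simp add: field_simps)
  ultimately have "cmod (f z - f 0) * ?b \<le> (bf + \<epsilon>) * t" by blast
  then show "cmod (f z - f 0) * ?b \<le> bf * t + e" using \<epsilon> by (simp add: algebra_simps)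
qed

text \<open>The maximum comes from weights: \<open>bloch_norm\<close> of the product is at most
  \<open>cmod (f 0)\<close> times \<open>bloch_norm D \<psi>\<close> plus \<open>beta D f\<close>
  times \<open>sup_norm D \<psi> + sigma_X D X \<psi>\<close>, and on the unit ball the two weights
  add up to at most 1.\<close>

lemma opnorm_le:
  "mult_opnorm D X \<psi> \<le> max (bloch_norm D \<psi>) (sup_norm D \<psi> + sigma_X D X \<psi>)"
proof -
  obtain m where m: "mult_opnorm D X \<psi> = ereal m" "0 \<le> m" using opnorm_real .
  have "ereal (cmod (\<psi> 0)) \<le> sup_norm D \<psi>" unfolding sup_norm_def using zero_in_D by (rule SUP_upper)
  then obtain s where s: "sup_norm D \<psi> = ereal s" "0 \<le> s"
    using sup_norm_le_opnorm m by (cases "sup_norm D \<psi>") (auto intro: order_trans[OF norm_ge_zero])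
  obtain b where b: "beta D \<psi> = ereal b" "0 \<le> b" using bloch_beta symbol_in_X X_bloch by blast
  show ?thesis
  proof (cases "sigma_X D X \<psi>")
    case PInf
    then show ?thesis using s by simp
  next
    case MInf
    then show ?thesis using sigma_nonneg by simp
  next
    case (real t)
    then have t: "sigma_X D X \<psi> = ereal t" "0 \<le> t" using sigma_nonneg by auto
    show ?thesis unfolding mult_opnorm_def
    proof (rule SUP_least)
      fix f assume "f \<in> {f \<in> X. bloch_norm D f \<le> 1}"
      then have f: "f \<in> X" and f1: "bloch_norm D f \<le> 1" by auto
      have hf: "holo f D" using f X_bloch bloch_holo by blast
      obtain bf where bf: "beta D f = ereal bf" "0 \<le> bf" using bloch_beta f X_bloch by blast
      have f01: "cmod (f 0) + bf \<le> 1" using f1 by (simp add: bloch_norm_def bf)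
      \<comment> \<open>\<open>bf * s\<close> bounds \<psi> times the gradient of f; of the gradient
        of \<psi>, the part with factor f(0) gives \<open>cmod (f 0) * b\<close> and the part with
        factor f - f(0) gives \<open>bf * t\<close>.\<close>
      have "beta D (\<lambda>z. \<psi> z * f z) \<le> ereal (cmod (f 0) * b + bf * (s + t))"
      proof (rule beta_least)
        fix z and u :: "complex^'n" assume z: "z \<in> D" and u: "u \<noteq> 0"
        let ?h = "sqrt (bergman_metric D z u)"
        have h: "0 < ?h" using z u by (rule sqrt_metric_pos)
        have "ereal (cmod (\<psi> z)) \<le> ereal s" unfolding s(1)[symmetric] sup_norm_def using z by (rule SUP_upper)
        then have "cmod (\<psi> z) * (cmod (grad_dir f z u) / ?h) \<le> s * bf"
          using grad_le_beta[OF z u bf(1)] h s by (intro mult_mono) auto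
        moreover have "cmod (f 0) * (cmod (grad_dir \<psi> z u) / ?h) \<le> cmod (f 0) * b"
          using grad_le_beta[OF z u b(1)] by (intro mult_left_mono) auto
        moreover note centered_mult_grad_le[OF f bf t z u]
        moreover have "cmod (grad_dir (\<lambda>z. \<psi> z * f z) z u)
            \<le> cmod (\<psi> z) * cmod (grad_dir f z u) + (cmod (f 0) + cmod (f z - f 0)) * cmod (grad_dir \<psi> z u)"
        proof -
          have "cmod (grad_dir (\<lambda>z. \<psi> z * f z) z u)
              \<le> cmod (\<psi> z) * cmod (grad_dir f z u) + cmod (f z) * cmod (grad_dir \<psi> z u)"
            unfolding grad_dir_mult[OF \<psi> hf z]
            using norm_triangle_ineq[of "\<psi> z * grad_dir f z u" "grad_dir \<psi> z u * f z"]
            by (simp add: norm_mult mult.commute)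
          also have "\<dots> \<le> cmod (\<psi> z) * cmod (grad_dir f z u) + (cmod (f 0) + cmod (f z - f 0)) * cmod (grad_dir \<psi> z u)"
            using norm_triangle_ineq[of "f 0" "f z - f 0"] by (intro add_left_mono mult_right_mono) auto
          finally show ?thesis .
        qed
        then have "cmod (grad_dir (\<lambda>z. \<psi> z * f z) z u) / ?h
            \<le> (cmod (\<psi> z) * cmod (grad_dir f z u) + (cmod (f 0) + cmod (f z - f 0)) * cmod (grad_dir \<psi> z u)) / ?h"
          using h by (intro divide_right_mono) auto
        ultimately show "cmod (grad_dir (\<lambda>z. \<psi> z * f z) z u) / ?h \<le> cmod (f 0) * b + bf * (s + t)"
          by (simp add: add_divide_distrib algebra_simps)
      qed
      then have "bloch_norm D (\<lambda>z. \<psi> z * f z)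
          \<le> ereal (cmod (\<psi> 0) * cmod (f 0)) + ereal (cmod (f 0) * b + bf * (s + t))"
        unfolding bloch_norm_def norm_mult by (rule add_left_mono)
      also have "\<dots> = ereal (cmod (f 0) * (cmod (\<psi> 0) + b) + bf * (s + t))"
        by (simp add: algebra_simps)
      also have "\<dots> \<le> ereal (max (cmod (\<psi> 0) + b) (s + t))"
      proof -
        let ?M = "max (cmod (\<psi> 0) + b) (s + t)"
        have "cmod (f 0) * (cmod (\<psi> 0) + b) + bf * (s + t) \<le> cmod (f 0) * ?M + bf * ?M"
          using bf by (intro add_mono mult_left_mono) auto
        also have "\<dots> = (cmod (f 0) + bf) * ?M" by (simp add: algebra_simps)
        also have "\<dots> \<le> 1 * ?M" using f01 s t by (intro mult_right_mono) auto
        finally show ?thesis by (simp only: ereal_less_eq mult_1)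
      qed
      also have "\<dots> = max (bloch_norm D \<psi>) (sup_norm D \<psi> + sigma_X D X \<psi>)"
        by (simp add: bloch_norm_def b s t)
      finally show "bloch_norm D (\<lambda>z. \<psi> z * f z) \<le> max (bloch_norm D \<psi>) (sup_norm D \<psi> + sigma_X D X \<psi>)" .
    qed
  qed
qed

theorem opnorm_bounds:
  "max (bloch_norm D \<psi>) (sup_norm D \<psi>) \<le> mult_opnorm D X \<psi> \<and>
   mult_opnorm D X \<psi> \<le> max (bloch_norm D \<psi>) (sup_norm D \<psi> + sigma_X D X \<psi>)"
  using bloch_norm_le_opnorm sup_norm_le_opnorm opnorm_le by simp

end

end

theorem mainTheorem7:
  fixes D :: "(complex^'n) set" and \<psi> :: "complex^'n \<Rightarrow> complex"
  assumes "domain D" and "bounded D" and "homogeneous D" and "0 \<in> D" and "holo \<psi> D"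
  shows "(mult_bounded D (bloch D) \<psi> \<longrightarrow>
           max (bloch_norm D \<psi>) (sup_norm D \<psi>) \<le> mult_opnorm D (bloch D) \<psi> \<and>
           mult_opnorm D (bloch D) \<psi> \<le>
             max (bloch_norm D \<psi>) (sup_norm D \<psi> + sigma_X D (bloch D) \<psi>))
       \<and> (mult_bounded D (little_bloch_star D) \<psi> \<longrightarrow>
           max (bloch_norm D \<psi>) (sup_norm D \<psi>) \<le> mult_opnorm D (little_bloch_star D) \<psi> \<and>
           mult_opnorm D (little_bloch_star D) \<psi> \<le>
             max (bloch_norm D \<psi>) (sup_norm D \<psi> + sigma_X D (little_bloch_star D) \<psi>))"
proof -
  interpret bloch_domain D
    using assms by unfold_locales (auto simp: domain_def)
  have "little_bloch_star D \<subseteq> bloch D" by (auto simp: little_bloch_star_def)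
  then show ?thesis
    using opnorm_bounds[of "bloch D" \<psi>] opnorm_bounds[of "little_bloch_star D" \<psi>] assms(5)
      const_in_bloch affine_in_bloch const_in_little_bloch affine_in_little_bloch
    by blast
qed

end
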